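(* The locus $X_\infty=X\cap\{s=0,\,v=0\}$ is parametrised by a pure spinor $\psi\in\Delta^+$ (nonzero, up to scale), and it is the homogeneous space $$X_\infty\simeq SO(10)/U(5).$$
   Context: $V=\mathbb{C}^{10}$ has standard basis $e^1,\dots,e^{10}$ and complex bilinear inner product; the Clifford algebra $e^ie^j+e^je^i=2\delta^{ij}$ acts on $\Delta=(\mathbb{C}^2)^{\otimes5}$ by $e^{2k-1}=\sigma_3^{\otimes(k-1)}\otimes\sigma_1\otimes1^{\otimes(5-k)}$, $e^{2k}=\sigma_3^{\otimes(k-1)}\otimes\sigma_2\otimes1^{\otimes(5-k)}$ ($\sigma_i$ Pauli matrices); $\Delta^\pm$ are the $\pm1$ eigenspaces of $(-i)^5e^1\cdots e^{10}$. Put $C=e^1e^3e^5e^7e^9$ and $(\phi\,a\,\psi)=\phi^TCa\psi$. A spinor $\psi\in\Delta^+$ is called pure if $(\psi e^i\psi)=0$ for all $i=1,\dots,10$. $X=E_6/(Spin(10)\times_{\mathbb{Z}_4}U(1))$ is realised as the subvariety of $\mathbb{C}P^{26}=\mathbb{P}(\mathbf{27})$, where $\mathbf{27}=V\oplus\Delta^+\oplus\mathbb{C}$ (as a $Spin(10)$ representation) with vectors $[v;\psi;s]$: it is the $E_6$-orbit of the line spanned by $\Psi_0=[0;0;1]$, which is the locus of the Plücker relations $2sv-\frac1{\sqrt2}\sum_i(\psi e^i\psi)e^i=0$, $v\psi=0$ (Clifford action), $v\cdot v=0$. *)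

theory Defs
  imports "HOL-Analysis.Analysis"
begin

section \<open>The spinor module\<close>

text \<open>
  \<open>(\<complex>\<^sup>2)\<^sup>\<otimes>\<^sup>5\<close> is the space of complex arrays indexed by 5-tuples over the
  two-element type \<open>2\<close>, and the tensor product of matrices is the Kronecker product (nested to
  the right, like the index type).
\<close>

type_synonym spinor = "complex ^ (2 \<times> 2 \<times> 2 \<times> 2 \<times> 2)"
type_synonym spin_mat = "complex ^ (2 \<times> 2 \<times> 2 \<times> 2 \<times> 2) ^ (2 \<times> 2 \<times> 2 \<times> 2 \<times> 2)"

definition kron :: "complex^'n^'m \<Rightarrow> complex^'q^'p \<Rightarrow> complex^('n \<times> 'q)^('m \<times> 'p)"
    (infixr "\<otimes>\<^sub>m" 75)
  where "A \<otimes>\<^sub>m B = (\<chi> i j. A $ fst i $ fst j * B $ snd i $ snd j)"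

definition \<sigma>1 :: "complex^2^2" where "\<sigma>1 = vector [vector [0, 1], vector [1, 0]]"
definition \<sigma>2 :: "complex^2^2" where "\<sigma>2 = vector [vector [0, -\<i>], vector [\<i>, 0]]"
definition \<sigma>3 :: "complex^2^2" where "\<sigma>3 = vector [vector [1, 0], vector [0, -1]]"
abbreviation I2 :: "complex^2^2" where "I2 \<equiv> mat 1"

text \<open>
  The generators \<open>e\<^sup>1, \<dots>, e\<^sup>1\<^sup>0\<close> as endomorphisms of the spinor module.
  In the numeral types \<open>2\<close>, \<open>5\<close> and \<open>10\<close> the last index is written \<open>2\<close>, \<open>5\<close>, \<open>10\<close>, which
  equals \<open>0\<close> there; \<^const>\<open>vector\<close> lists entries in the order \<open>1, 2, \<dots>\<close> accordingly.
\<close>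

definition \<gamma> :: "spin_mat ^ 10" where
  "\<gamma> = vector
    [\<sigma>1 \<otimes>\<^sub>m I2 \<otimes>\<^sub>m I2 \<otimes>\<^sub>m I2 \<otimes>\<^sub>m I2,
     \<sigma>2 \<otimes>\<^sub>m I2 \<otimes>\<^sub>m I2 \<otimes>\<^sub>m I2 \<otimes>\<^sub>m I2,
     \<sigma>3 \<otimes>\<^sub>m \<sigma>1 \<otimes>\<^sub>m I2 \<otimes>\<^sub>m I2 \<otimes>\<^sub>m I2,
     \<sigma>3 \<otimes>\<^sub>m \<sigma>2 \<otimes>\<^sub>m I2 \<otimes>\<^sub>m I2 \<otimes>\<^sub>m I2,
     \<sigma>3 \<otimes>\<^sub>m \<sigma>3 \<otimes>\<^sub>m \<sigma>1 \<otimes>\<^sub>m I2 \<otimes>\<^sub>m I2,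
     \<sigma>3 \<otimes>\<^sub>m \<sigma>3 \<otimes>\<^sub>m \<sigma>2 \<otimes>\<^sub>m I2 \<otimes>\<^sub>m I2,
     \<sigma>3 \<otimes>\<^sub>m \<sigma>3 \<otimes>\<^sub>m \<sigma>3 \<otimes>\<^sub>m \<sigma>1 \<otimes>\<^sub>m I2,
     \<sigma>3 \<otimes>\<^sub>m \<sigma>3 \<otimes>\<^sub>m \<sigma>3 \<otimes>\<^sub>m \<sigma>2 \<otimes>\<^sub>m I2,
     \<sigma>3 \<otimes>\<^sub>m \<sigma>3 \<otimes>\<^sub>m \<sigma>3 \<otimes>\<^sub>m \<sigma>3 \<otimes>\<^sub>m \<sigma>1,
     \<sigma>3 \<otimes>\<^sub>m \<sigma>3 \<otimes>\<^sub>m \<sigma>3 \<otimes>\<^sub>m \<sigma>3 \<otimes>\<^sub>m \<sigma>2]"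

definition chirality :: spin_mat where
  "chirality = mat ((-\<i>) ^ 5) **
     (\<gamma>$1 ** \<gamma>$2 ** \<gamma>$3 ** \<gamma>$4 ** \<gamma>$5 ** \<gamma>$6 ** \<gamma>$7 ** \<gamma>$8 ** \<gamma>$9 ** \<gamma>$10)"

definition \<Delta>_plus :: "spinor set" where
  "\<Delta>_plus = {\<psi>. chirality *v \<psi> = \<psi>}"

definition charge_conj :: spin_mat where
  "charge_conj = \<gamma>$1 ** \<gamma>$3 ** \<gamma>$5 ** \<gamma>$7 ** \<gamma>$9"

text \<open>The element of the Clifford algebra given by a vector; \<^term>\<open>mat c\<close> is the scalar \<open>c\<close>.\<close>

definition cliff :: "complex^10 \<Rightarrow> spin_mat" where
  "cliff v = (\<Sum>i\<in>UNIV. mat (v$i) ** \<gamma>$i)"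

definition spin_form :: "spinor \<Rightarrow> spin_mat \<Rightarrow> spinor \<Rightarrow> complex" where
  "spin_form \<phi> a \<psi> = (\<Sum>k\<in>UNIV. \<phi>$k * ((charge_conj ** a) *v \<psi>) $ k)"

definition pure_spinor :: "spinor \<Rightarrow> bool" where
  "pure_spinor \<psi> \<longleftrightarrow> \<psi> \<in> \<Delta>_plus \<and> (\<forall>i. spin_form \<psi> (\<gamma>$i) \<psi> = 0)"

section \<open>Quotient topology\<close>

text \<open>The finest topology on \<^term>\<open>f ` topspace T\<close> for which \<^term>\<open>f\<close> is continuous.\<close>

definition quot_topology :: "'a topology \<Rightarrow> ('a \<Rightarrow> 'b) \<Rightarrow> 'b topology" where
  "quot_topology T f = topology
     (\<lambda>U. U \<subseteq> f ` topspace T \<and> openin T {x \<in> topspace T. f x \<in> U})"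

section \<open>The projective space of the 27-dimensional representation\<close>

text \<open>A vector \<open>[v; \<psi>; s]\<close> is a triple \<^term>\<open>(v, \<psi>, s)\<close> with \<^term>\<open>\<psi> \<in> \<Delta>_plus\<close>.\<close>

type_synonym vec27 = "(complex^10) \<times> spinor \<times> complex"

definition rep27 :: "vec27 set" where
  "rep27 = {(v, \<psi>, s). \<psi> \<in> \<Delta>_plus}"

fun scale27 :: "complex \<Rightarrow> vec27 \<Rightarrow> vec27" where
  "scale27 c (v, \<psi>, s) = (c *s v, c *s \<psi>, c * s)"

definition cline :: "vec27 \<Rightarrow> vec27 set" where
  "cline w = range (\<lambda>c. scale27 c w)"

definition CP26 :: "vec27 set set" where
  "CP26 = cline ` (rep27 - {0})"

definition CP26_topology :: "vec27 set topology" where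
  "CP26_topology = quot_topology (top_of_set (rep27 - {0})) cline"

fun pluecker :: "vec27 \<Rightarrow> bool" where
  "pluecker (v, \<psi>, s) \<longleftrightarrow>
     (2 * s) *s v
       - (1 / complex_of_real (sqrt 2)) *s (\<Sum>i\<in>UNIV. spin_form \<psi> (\<gamma>$i) \<psi> *s axis i 1) = 0
     \<and> cliff v *v \<psi> = 0
     \<and> (\<Sum>i\<in>UNIV. v$i * v$i) = 0"

definition X_var :: "vec27 set set" where
  "X_var = {p \<in> CP26. \<forall>w\<in>p. pluecker w}"

definition X_infinity :: "vec27 set set" where
  "X_infinity = X_var \<inter> {p. \<forall>(v, \<psi>, s)\<in>p. s = 0 \<and> v = 0}"

section \<open>The homogeneous space SO(10)/U(5)\<close>

definition SO10 :: "(real^10^10) set" where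
  "SO10 = {A. orthogonal_matrix A \<and> det A = 1}"

text \<open>The standard embedding: \<open>\<real>\<^sup>1\<^sup>0 = \<complex>\<^sup>5\<close> by \<open>z\<^sub>k = x\<^sub>2\<^sub>k\<^sub>-\<^sub>1 + \<i> x\<^sub>2\<^sub>k\<close>.\<close>

definition to_C5 :: "real^10 \<Rightarrow> complex^5" where
  "to_C5 x = vector [Complex (x$1) (x$2), Complex (x$3) (x$4), Complex (x$5) (x$6),
                     Complex (x$7) (x$8), Complex (x$9) (x$10)]"

definition unitary_matrix :: "complex^'n^'n \<Rightarrow> bool" where
  "unitary_matrix B \<longleftrightarrow>
     (\<chi> i j. cnj (B$j$i)) ** B = mat 1 \<and> B ** (\<chi> i j. cnj (B$j$i)) = mat 1"

definition U5 :: "(real^10^10) set" where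
  "U5 = {A. \<exists>B. unitary_matrix B \<and> (\<forall>x. to_C5 (A *v x) = B *v to_C5 x)}"

definition coset_U5 :: "real^10^10 \<Rightarrow> (real^10^10) set" where
  "coset_U5 A = (\<lambda>h. A ** h) ` U5"

definition SO10_mod_U5 :: "(real^10^10) set topology" where
  "SO10_mod_U5 = quot_topology (top_of_set SO10) coset_U5"

section \<open>The action of Spin(10)\<close>

definition cvec :: "real^10 \<Rightarrow> complex^10" where
  "cvec x = (\<chi> i. complex_of_real (x$i))"

definition cmat :: "real^10^10 \<Rightarrow> complex^10^10" where
  "cmat A = (\<chi> i j. complex_of_real (A$i$j))"

text \<open>Products of an even number of real unit vectors in the Clifford algebra.\<close>

inductive_set Spin10 :: "spin_mat set" where
  Spin10_one: "mat 1 \<in> Spin10"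
| Spin10_step: "norm u = 1 \<Longrightarrow> norm w = 1 \<Longrightarrow> g \<in> Spin10 \<Longrightarrow>
                  cliff (cvec u) ** cliff (cvec w) ** g \<in> Spin10"

text \<open>The double covering of SO(10): \<open>g u g\<^sup>-\<^sup>1 = \<rho>(g) u\<close> for \<open>u \<in> \<real>\<^sup>1\<^sup>0\<close>.\<close>

definition vec_rep :: "spin_mat \<Rightarrow> real^10^10" where
  "vec_rep g = (THE A. \<forall>u. cliff (cvec (A *v u)) = g ** cliff (cvec u) ** matrix_inv g)"

fun spin_act :: "spin_mat \<Rightarrow> vec27 \<Rightarrow> vec27" where
  "spin_act g (v, \<psi>, s) = (cmat (vec_rep g) *v v, g *v \<psi>, s)"

end

theory Submission
  imports Defs
begin

text \<open>
  A spinor \<open>\<psi>\<close> with \<open>s = 0\<close> and \<open>v = 0\<close> satisfies the Pluecker relations exactly when it is pure, so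
  \<^const>\<open>X_infinity\<close> is the set of lines of pure spinors.  What has to be shown is that these lines form a
  single orbit of \<open>SO(10)\<close> with stabiliser \<open>U(5)\<close>.

  The link between the two sides is the annihilator \<open>{w. w \<psi> = 0}\<close> of a spinor in \<open>\<complex>\<^sup>1\<^sup>0\<close>.  For the vacuum
  spinor it is \<open>{x + \<i> J x | x real}\<close>, where \<open>J\<close> is multiplication by \<open>\<i>\<close> on \<open>\<real>\<^sup>1\<^sup>0 = \<complex>\<^sup>5\<close>, and the
  vacuum is the only spinor, up to scale, that it kills.  Attach to \<open>A \<in> SO(10)\<close> the space of
  spinors killed by all \<open>A x + \<i> A J x\<close> (\<open>fock_line\<close>).  Every orthogonal matrix is a product of
  reflections (Cartan and Dieudonne), hence is covered by a product \<open>g\<close> of unit vectors in the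
  Clifford algebra, and the space attached to \<open>A\<close> is the line through \<open>g\<close> times the vacuum.  It consists of
  pure spinors because \<open>g\<close> preserves purity, and of spinors in \<open>\<Delta>\<^sup>+\<close> because \<open>det A = 1\<close> makes \<open>g\<close> commute with the
  chirality operator.  Two matrices \<open>A\<close> and \<open>B\<close> have the same line iff \<open>B\<^sup>-\<^sup>1 A\<close> commutes with \<open>J\<close>, that is,
  iff \<open>B\<^sup>-\<^sup>1 A\<close> lies in \<open>U(5)\<close>.

  The main point is that every pure spinor arises in this way.  In ten dimensions every
  \<open>\<psi> \<in> \<Delta>\<^sup>+\<close> satisfies the cubic Fierz identity \<open>\<Sum>\<^sub>i (\<psi> e\<^sup>i \<psi>) e\<^sup>i \<psi> = 0\<close> (\<open>cliff_square_vec\<close>).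
  Polarising it at a pure \<open>\<psi>\<close> shows that all the vectors \<open>\<Sum>\<^sub>i (\<psi> e\<^sup>i \<phi>) e\<^sup>i\<close> kill \<open>\<psi>\<close>.  A real vector
  orthogonal to the real parts of all annihilating vectors is therefore itself annihilating, and then it
  is zero, because a real vector squares to its squared length.  So each real \<open>x\<close> is
  the real part of an annihilating vector \<open>x + \<i> K x\<close>; the map \<open>K\<close> is an orthogonal complex structure
  (\<open>pure_complex_structure\<close>), and a unitary frame for \<open>K\<close> provides \<open>A\<close> with \<open>K = A J A\<^sup>-\<^sup>1\<close>.

  For the topology, the relation ``\<open>\<psi>\<close> lies on the line of \<open>A\<close>'' is closed.  Projecting it along the compact
  group \<open>SO(10)\<close> shows that the map to \<^const>\<open>X_infinity\<close> is closed, and projecting it along the compact unit sphere of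
  \<open>\<Delta>\<^sup>+\<close> shows that it is continuous.
\<close>

section \<open>Spinor coordinates\<close>

lemma exhaust_10: fixes x :: 10 shows "x=1\<or>x=2\<or>x=3\<or>x=4\<or>x=5\<or>x=6\<or>x=7\<or>x=8\<or>x=9\<or>x=10"
proof (induct x)
  case (of_int z)
  hence "z = 0 \<or> z = 1 \<or> z = 2 \<or> z = 3 \<or> z = 4 \<or> z = 5 \<or> z = 6 \<or> z = 7 \<or> z = 8 \<or> z = 9"
    by simp presburger
  thus ?case by auto
qed

lemma UNIV_10: "UNIV = {1,2,3,4,5,6,7,8,9,10::10}"
  using exhaust_10 by blast

lemma sum_10: "sum f (UNIV::10 set) = f 1 + f 2 + f 3 + f 4 + f 5 + f 6 + f 7 + f 8 + f 9 + f 10"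
  unfolding UNIV_10 by (simp add: ac_simps)

lemma vector_10:
  "(vector [a,b,c,d,e,f,g,h,i,j] :: 'a::zero^10)$1 = a"
  "(vector [a,b,c,d,e,f,g,h,i,j] :: 'a::zero^10)$2 = b"
  "(vector [a,b,c,d,e,f,g,h,i,j] :: 'a::zero^10)$3 = c"
  "(vector [a,b,c,d,e,f,g,h,i,j] :: 'a::zero^10)$4 = d"
  "(vector [a,b,c,d,e,f,g,h,i,j] :: 'a::zero^10)$5 = e"
  "(vector [a,b,c,d,e,f,g,h,i,j] :: 'a::zero^10)$6 = f"
  "(vector [a,b,c,d,e,f,g,h,i,j] :: 'a::zero^10)$7 = g"
  "(vector [a,b,c,d,e,f,g,h,i,j] :: 'a::zero^10)$8 = h"
  "(vector [a,b,c,d,e,f,g,h,i,j] :: 'a::zero^10)$9 = i"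
  "(vector [a,b,c,d,e,f,g,h,i,j] :: 'a::zero^10)$10 = j"
  unfolding vector_def by (simp_all)

text \<open>The basis of the spinor module is indexed by five bits, where \<open>1\<close> is the first index of each factor
  \<open>\<complex>\<^sup>2\<close>.  Then \<open>\<sigma>\<^sub>3\<close> is the sign of a bit, and \<open>\<sigma>\<^sub>1\<close> and \<open>\<sigma>\<^sub>2\<close> flip the bit, the latter with a phase.\<close>

definition bit_sign :: "2 \<Rightarrow> complex" where "bit_sign a = (if a = 1 then 1 else -1)"
definition bit_flip :: "2 \<Rightarrow> 2" where "bit_flip a = (if a = 1 then 2 else 1)"

lemma bit_simps [simp]:
  "bit_sign 1 = 1" "bit_sign 2 = -1" "bit_flip 1 = 2" "bit_flip 2 = 1"
  "bit_flip (bit_flip a) = a" "bit_sign (bit_flip a) = - bit_sign a"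
  "bit_sign a * bit_sign a = 1" "bit_sign a * (bit_sign a * z) = z"
  using exhaust_2[of a] by (auto simp: bit_sign_def bit_flip_def)

lemma kron_mv:
  "((A \<otimes>\<^sub>m B) *v \<psi>) $ (a,b) = (\<Sum>a'\<in>UNIV. A$a$a' * (B *v (\<chi> b'. \<psi>$(a',b'))) $ b)"
  unfolding kron_def matrix_vector_mult_def UNIV_Times_UNIV[symmetric]
  by (simp add: sum_distrib_left mult.assoc sum.cartesian_product split_def del: UNIV_Times_UNIV)

lemma sum_sigma1: "(\<Sum>a'\<in>UNIV. \<sigma>1$a$a' * f a') = f (bit_flip a)"
  and sum_sigma2: "(\<Sum>a'\<in>UNIV. \<sigma>2$a$a' * f a') = - \<i> * bit_sign a * f (bit_flip a)"
  and sum_sigma3: "(\<Sum>a'\<in>UNIV. \<sigma>3$a$a' * f a') = bit_sign a * f a"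
  using exhaust_2[of a] by (auto simp: \<sigma>1_def \<sigma>2_def \<sigma>3_def sum_2)

lemma sum_I2: "(\<Sum>a'\<in>UNIV. I2$a$a' * f a') = f a"
  using exhaust_2[of a] by (auto simp: mat_def sum_2)

lemma sigma_mv: "(\<sigma>1 *v x)$a = x$bit_flip a" "(\<sigma>2 *v x)$a = - \<i> * bit_sign a * x$bit_flip a"
  using sum_sigma1[of a "\<lambda>k. x$k"] sum_sigma2[of a "\<lambda>k. x$k"] by (simp_all add: matrix_vector_mult_def)

lemmas kron_sigma_mv = kron_mv sum_I2 sum_sigma1 sum_sigma2 sum_sigma3 sigma_mv matrix_vector_mul_lid

text \<open>Each generator flips one bit, with the sign that the factors \<open>\<sigma>\<^sub>3\<close> to its left produce (Jordan and Wigner).\<close>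

lemma gamma_mv:
 "(\<gamma>$1 *v \<psi>)$(a,b,c,d,e) = \<psi>$(bit_flip a,b,c,d,e)"
 "(\<gamma>$2 *v \<psi>)$(a,b,c,d,e) = - \<i> * bit_sign a * \<psi>$(bit_flip a,b,c,d,e)"
 "(\<gamma>$3 *v \<psi>)$(a,b,c,d,e) = bit_sign a * \<psi>$(a,bit_flip b,c,d,e)"
 "(\<gamma>$4 *v \<psi>)$(a,b,c,d,e) = bit_sign a * (- \<i> * bit_sign b) * \<psi>$(a,bit_flip b,c,d,e)"
 "(\<gamma>$5 *v \<psi>)$(a,b,c,d,e) = bit_sign a * bit_sign b * \<psi>$(a,b,bit_flip c,d,e)"
 "(\<gamma>$6 *v \<psi>)$(a,b,c,d,e) = bit_sign a * bit_sign b * (- \<i> * bit_sign c) * \<psi>$(a,b,bit_flip c,d,e)"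
 "(\<gamma>$7 *v \<psi>)$(a,b,c,d,e) = bit_sign a * bit_sign b * bit_sign c * \<psi>$(a,b,c,bit_flip d,e)"
 "(\<gamma>$8 *v \<psi>)$(a,b,c,d,e) = bit_sign a * bit_sign b * bit_sign c * (- \<i> * bit_sign d) * \<psi>$(a,b,c,bit_flip d,e)"
 "(\<gamma>$9 *v \<psi>)$(a,b,c,d,e) = bit_sign a * bit_sign b * bit_sign c * bit_sign d * \<psi>$(a,b,c,d,bit_flip e)"
 "(\<gamma>$10 *v \<psi>)$(a,b,c,d,e) = bit_sign a * bit_sign b * bit_sign c * bit_sign d * (- \<i> * bit_sign e) * \<psi>$(a,b,c,d,bit_flip e)"
  unfolding \<gamma>_def vector_10 by (simp_all add: kron_sigma_mv mult.assoc sum_negf)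

lemma mat_scalar_mv: "mat c *v (x :: complex^'n) = c *s x"
  by (simp add: vec_eq_iff mat_def matrix_vector_mult_def if_distrib[of "\<lambda>t. t * _"] cong: if_cong)

lemma cliff_gamma: "cliff v *v \<psi> = (\<Sum>i\<in>UNIV. v$i *s (\<gamma>$i *v \<psi>))"
  unfolding cliff_def
  by (simp add: sum_10 matrix_vector_mult_add_rdistrib matrix_vector_mul_assoc[symmetric] mat_scalar_mv)

lemma cliff_mv:
  "(cliff v *v \<psi>)$(a,b,c,d,e) =
    (v$1 - \<i> * bit_sign a * v$2) * \<psi>$(bit_flip a,b,c,d,e)
  + bit_sign a * (v$3 - \<i> * bit_sign b * v$4) * \<psi>$(a,bit_flip b,c,d,e)
  + bit_sign a * bit_sign b * (v$5 - \<i> * bit_sign c * v$6) * \<psi>$(a,b,bit_flip c,d,e)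
  + bit_sign a * bit_sign b * bit_sign c * (v$7 - \<i> * bit_sign d * v$8) * \<psi>$(a,b,c,bit_flip d,e)
  + bit_sign a * bit_sign b * bit_sign c * bit_sign d * (v$9 - \<i> * bit_sign e * v$10) * \<psi>$(a,b,c,d,bit_flip e)"
  by (simp add: cliff_gamma sum_10 gamma_mv algebra_simps)

text \<open>The defining relation of the Clifford algebra: the mixed terms flip two different bits and cancel in
  pairs, because the earlier bit enters the sign of the later generator.\<close>

lemma cliff_square: "cliff v *v (cliff v *v \<psi>) = (\<Sum>i\<in>UNIV. v$i * v$i) *s \<psi>"
  apply (simp add: vec_eq_iff split_paired_all cliff_mv sum_10)
  apply (simp add: algebra_simps)
  done

lemma chirality_mv:
  "(chirality *v \<psi>)$(a,b,c,d,e) =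
    bit_sign a * bit_sign b * bit_sign c * bit_sign d * bit_sign e * \<psi>$(a,b,c,d,e)"
  unfolding chirality_def
  by (simp add: matrix_vector_mul_assoc[symmetric] mat_scalar_mv gamma_mv power_numeral_reduce ac_simps)

lemma charge_conj_mv:
  "(charge_conj *v \<psi>)$(a,b,c,d,e) =
    bit_sign b * bit_sign d * \<psi>$(bit_flip a,bit_flip b,bit_flip c,bit_flip d,bit_flip e)"
  unfolding charge_conj_def
  by (simp add: matrix_vector_mul_assoc[symmetric] gamma_mv ac_simps)

section \<open>The invariant pairing and the cubic Fierz identity\<close>

definition spinor_pairing :: "spinor \<Rightarrow> spinor \<Rightarrow> complex" where
  "spinor_pairing \<phi> \<psi> = (\<Sum>k\<in>UNIV. \<phi>$k * (charge_conj *v \<psi>) $ k)"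

lemma spin_form_eq_pairing: "spin_form \<phi> a \<psi> = spinor_pairing \<phi> (a *v \<psi>)"
  by (simp add: spin_form_def spinor_pairing_def matrix_vector_mul_assoc)

lemma sum_spinor:
  "(\<Sum>k\<in>UNIV. f (k :: 2 \<times> 2 \<times> 2 \<times> 2 \<times> 2)) =
    (\<Sum>a\<in>UNIV. \<Sum>b\<in>UNIV. \<Sum>c\<in>UNIV. \<Sum>d\<in>UNIV. \<Sum>e\<in>UNIV. f (a,b,c,d,e))"
  by (simp add: sum.cartesian_product split_def)

lemma spinor_pairing_sym: "spinor_pairing \<phi> \<psi> = spinor_pairing \<psi> \<phi>"
  by (simp add: spinor_pairing_def sum_spinor charge_conj_mv sum_2)

lemma spinor_pairing_linear:
  "spinor_pairing (\<phi> + \<psi>) \<xi> = spinor_pairing \<phi> \<xi> + spinor_pairing \<psi> \<xi>"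
  "spinor_pairing \<xi> (\<phi> + \<psi>) = spinor_pairing \<xi> \<phi> + spinor_pairing \<xi> \<psi>"
  "spinor_pairing (\<phi> - \<psi>) \<xi> = spinor_pairing \<phi> \<xi> - spinor_pairing \<psi> \<xi>"
  "spinor_pairing \<xi> (\<phi> - \<psi>) = spinor_pairing \<xi> \<phi> - spinor_pairing \<xi> \<psi>"
  "spinor_pairing (k *s \<phi>) \<xi> = k * spinor_pairing \<phi> \<xi>" "spinor_pairing \<xi> (k *s \<phi>) = k * spinor_pairing \<xi> \<phi>"
  by (simp_all add: spinor_pairing_def matrix_vector_right_distrib sum.distrib matrix_vector_mult_diff_distrib sum_subtractf
   vector_scalar_commute algebra_simps sum_distrib_left)

text \<open>Vectors are self-adjoint for the pairing: \<open>C\<close> is a product of the five symmetric generators, hence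
  symmetric up to the reordering sign \<open>+1\<close>; it commutes with these five and anticommutes with the other
  five, which are antisymmetric.\<close>

lemma spinor_pairing_cliff: "spinor_pairing (cliff u *v \<phi>) \<psi> = spinor_pairing \<phi> (cliff u *v \<psi>)"
  apply (simp add: spinor_pairing_def sum_spinor charge_conj_mv cliff_mv sum_2)
  apply (simp add: algebra_simps)
  done

lemma Delta_plus_odd_zero:
  "\<psi> \<in> \<Delta>_plus \<Longrightarrow>
    bit_sign a * bit_sign b * bit_sign c * bit_sign d * bit_sign e = -1 \<Longrightarrow> \<psi>$(a,b,c,d,e) = 0"
proof -
  assume p: "\<psi> \<in> \<Delta>_plus" and m: "bit_sign a * bit_sign b * bit_sign c * bit_sign d * bit_sign e = -1"
  have "(chirality *v \<psi>) $ (a,b,c,d,e) = \<psi> $ (a,b,c,d,e)"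
    using p by (simp add: \<Delta>_plus_def)
  thus ?thesis unfolding chirality_mv m by (simp add: equal_neg_zero neg_equal_zero)
qed

definition square_vec :: "spinor \<Rightarrow> complex^10" where
  "square_vec \<psi> = (\<chi> i. spin_form \<psi> (\<gamma>$i) \<psi>)"

text \<open>The cubic Fierz identity.  Only the sixteen components of \<open>\<psi>\<close> with an even number of flipped bits
  survive, and in terms of them each component of the left-hand side is a sum of cubic monomials that
  cancel.\<close>

lemma cliff_square_vec:
  assumes "\<psi> \<in> \<Delta>_plus"
  shows "cliff (square_vec \<psi>) *v \<psi> = 0"
proof -
  have z: "\<psi>$(a,b,c,d,e) = 0" if "bit_sign a * bit_sign b * bit_sign c * bit_sign d * bit_sign e = -1" for a b c d e
    using Delta_plus_odd_zero[OF assms that] .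
  \<comment> \<open>The components with an odd number of flipped bits vanish.\<close>
  note zz = z[of 1 1 1 1 2, simplified] z[of 1 1 1 2 1, simplified] z[of 1 1 2 1 1, simplified] z[of 1 2 1 1 1, simplified]
    z[of 2 1 1 1 1, simplified]
    z[of 1 1 2 2 2, simplified] z[of 1 2 1 2 2, simplified] z[of 1 2 2 1 2, simplified] z[of 1 2 2 2 1, simplified]
    z[of 2 1 1 2 2, simplified] z[of 2 1 2 1 2, simplified] z[of 2 1 2 2 1, simplified]
    z[of 2 2 1 1 2, simplified] z[of 2 2 1 2 1, simplified] z[of 2 2 2 1 1, simplified] z[of 2 2 2 2 2, simplified]
  have q: "square_vec \<psi> $ i = spinor_pairing \<psi> (\<gamma>$i *v \<psi>)" for i by (simp add: square_vec_def spin_form_eq_pairing)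
  note qq = q[of 1] q[of 2] q[of 3] q[of 4] q[of 5] q[of 6] q[of 7] q[of 8] q[of 9] q[of 10]
  note Q = qq[unfolded spinor_pairing_def sum_spinor sum_2 charge_conj_mv, simplified gamma_mv zz bit_simps, simplified]
  have c: "a = 1 \<or> a = 2" for a :: 2 by (rule exhaust_2)
  show ?thesis
    unfolding vec_eq_iff split_paired_All
  proof (intro allI)
    fix a b c d e
    show "(cliff (square_vec \<psi>) *v \<psi>) $ (a, b, c, d, e) = 0 $ (a, b, c, d, e)"
      unfolding cliff_mv Q
      using c[of a] c[of b] c[of c] c[of d] c[of e]
      by (elim disjE) (simp_all add: zz, simp_all add: algebra_simps)
  qed
qed

section \<open>The Clifford action of vectors\<close>

lemma cliff_add: "cliff (u + v) *v \<psi> = cliff u *v \<psi> + cliff v *v \<psi>"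
  by (simp add: cliff_gamma vector_sadd_rdistrib sum.distrib)

lemma cliff_scale: "cliff (c *s u) *v \<psi> = c *s (cliff u *v \<psi>)"
  by (simp add: cliff_gamma vec.scale_sum_right vector_smult_assoc)

lemma cliff_zero: "cliff 0 *v \<psi> = 0"
  using cliff_scale[of 0 0 \<psi>] by simp

lemma cliff_diff: "cliff (u - v) *v \<psi> = cliff u *v \<psi> - cliff v *v \<psi>"
  using cliff_add[of "u - v" v \<psi>] by simp

lemma cliff_axis: "cliff (axis i 1) *v \<psi> = \<gamma>$i *v \<psi>"
proof -
  have "axis i (1::complex) $ j *s (\<gamma>$j *v \<psi>) = (if j = i then \<gamma>$i *v \<psi> else 0)" for j
    by (simp add: axis_def)
  thus ?thesis by (simp add: cliff_gamma)
qed

lemma cliff_anticomm: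
  "cliff u *v (cliff v *v \<psi>) + cliff v *v (cliff u *v \<psi>) = (2 * (\<Sum>i\<in>UNIV. u$i * v$i)) *s \<psi>"
proof -
  have "cliff (u+v) *v (cliff (u+v) *v \<psi>) =
      cliff u *v (cliff u *v \<psi>) + cliff v *v (cliff v *v \<psi>)
      + (cliff u *v (cliff v *v \<psi>) + cliff v *v (cliff u *v \<psi>))"
    by (simp add: cliff_add matrix_vector_right_distrib)
  moreover have "(\<Sum>i\<in>UNIV. (u+v)$i * (u+v)$i)
      = (\<Sum>i\<in>UNIV. u$i * u$i) + (\<Sum>i\<in>UNIV. v$i * v$i) + 2 * (\<Sum>i\<in>UNIV. u$i * v$i)"
    by (simp add: algebra_simps sum.distrib sum_distrib_left)
  ultimately show ?thesis
    unfolding cliff_square by (simp add: vector_sadd_rdistrib)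
qed

lemma cvec_simps: "cvec (x + y) = cvec x + cvec y" "cvec (x - y) = cvec x - cvec y"
  "cvec (r *\<^sub>R x) = complex_of_real r *s cvec x"
  by (simp_all add: cvec_def vec_eq_iff)

lemma cvec_dot: "(\<Sum>i\<in>UNIV. cvec x$i * cvec y$i) = complex_of_real (x \<bullet> y)"
  by (simp add: cvec_def inner_vec_def)

lemma cliff_cvec_anticomm:
  "cliff (cvec x) *v (cliff (cvec y) *v \<psi>) =
    complex_of_real (2 * (x \<bullet> y)) *s \<psi> - cliff (cvec y) *v (cliff (cvec x) *v \<psi>)"
  using cliff_anticomm[of "cvec x" "cvec y" \<psi>] unfolding cvec_dot by (simp add: eq_diff_eq)

lemma cliff_cvec_square: "cliff (cvec x) *v (cliff (cvec x) *v \<psi>) = complex_of_real (x \<bullet> x) *s \<psi>"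
  unfolding cliff_square cvec_dot ..

text \<open>A real vector kills no nonzero spinor, because its square is its squared length.  Hence a vector that
  annihilates a spinor is determined by its real part.\<close>

lemma cliff_cvec_eq_0D: "cliff (cvec x) *v \<psi> = 0 \<Longrightarrow> \<psi> \<noteq> 0 \<Longrightarrow> x = 0"
  using cliff_cvec_square[of x \<psi>] by simp

lemma chirality_cliff: "chirality *v (cliff v *v \<psi>) = - (cliff v *v (chirality *v \<psi>))"
  by (simp add: vec_eq_iff split_paired_all chirality_mv cliff_mv) (simp add: algebra_simps)

lemma spinor_pairing_gamma_sum:
  "(\<Sum>i\<in>UNIV. u$i * spinor_pairing \<phi> (\<gamma>$i *v \<psi>)) = spinor_pairing \<phi> (cliff u *v \<psi>)"
  by (simp add: cliff_gamma sum_10 spinor_pairing_linear)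

lemma pure_spinor_iff_pairing:
  "pure_spinor \<psi> \<longleftrightarrow> \<psi> \<in> \<Delta>_plus \<and> (\<forall>v. spinor_pairing \<psi> (cliff v *v \<psi>) = 0)"
proof -
  have "(\<forall>i. spinor_pairing \<psi> (\<gamma>$i *v \<psi>) = 0) \<longleftrightarrow> (\<forall>v. spinor_pairing \<psi> (cliff v *v \<psi>) = 0)"
    by (metis (no_types, lifting) spinor_pairing_gamma_sum cliff_axis mult_zero_right sum.neutral)
  thus ?thesis by (simp add: pure_spinor_def spin_form_eq_pairing)
qed

section \<open>The annihilator of a pure spinor\<close>

definition polar_vec :: "spinor \<Rightarrow> spinor \<Rightarrow> complex^10" where
  "polar_vec \<psi> \<phi> = (\<chi> i. spinor_pairing \<psi> (\<gamma>$i *v \<phi>))"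

lemma spinor_pairing_gamma_sym: "spinor_pairing \<phi> (\<gamma>$i *v \<psi>) = spinor_pairing \<psi> (\<gamma>$i *v \<phi>)"
  by (metis spinor_pairing_cliff spinor_pairing_sym cliff_axis)

lemma Delta_plus_add: "\<phi> \<in> \<Delta>_plus \<Longrightarrow> \<psi> \<in> \<Delta>_plus \<Longrightarrow> \<phi> + \<psi> \<in> \<Delta>_plus"
  and Delta_plus_diff: "\<phi> \<in> \<Delta>_plus \<Longrightarrow> \<psi> \<in> \<Delta>_plus \<Longrightarrow> \<phi> - \<psi> \<in> \<Delta>_plus"
  and Delta_plus_scale: "\<phi> \<in> \<Delta>_plus \<Longrightarrow> c *s \<phi> \<in> \<Delta>_plus"
  by (simp_all add: \<Delta>_plus_def matrix_vector_right_distrib matrix_vector_mult_diff_distrib vector_scalar_commute)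

text \<open>The Fierz identity at \<open>\<psi> + \<phi>\<close> and at \<open>\<psi> - \<phi>\<close>: their difference isolates the terms of odd degree in
  \<open>\<phi>\<close>, purity of \<open>\<psi>\<close> removes the terms \<open>(\<psi> e\<^sup>i \<psi>) e\<^sup>i \<phi>\<close>, and the identity for \<open>\<phi>\<close> itself
  removes the cubic one.\<close>

lemma cliff_polar_vec:
  assumes p: "pure_spinor \<psi>" and f: "\<phi> \<in> \<Delta>_plus"
  shows "cliff (polar_vec \<psi> \<phi>) *v \<psi> = 0"
proof -
  have ps: "\<psi> \<in> \<Delta>_plus" and q0: "square_vec \<psi> = 0"
    using p by (simp_all add: pure_spinor_def square_vec_def vec_eq_iff)
  have q: "square_vec (\<psi> + \<phi>) = square_vec \<phi> + 2 *s polar_vec \<psi> \<phi>"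
    "square_vec (\<psi> - \<phi>) = square_vec \<phi> - 2 *s polar_vec \<psi> \<phi>"
    using q0 by (simp_all add: vec_eq_iff square_vec_def polar_vec_def spin_form_eq_pairing spinor_pairing_linear matrix_vector_right_distrib
      matrix_vector_mult_diff_distrib spinor_pairing_gamma_sym[of \<phi> _ \<psi>])
  have "cliff (square_vec (\<psi> + \<phi>)) *v (\<psi> + \<phi>) = 0"
    "cliff (square_vec (\<psi> - \<phi>)) *v (\<psi> - \<phi>) = 0"
    using cliff_square_vec Delta_plus_add Delta_plus_diff ps f by blast+
  moreover have "cliff (square_vec \<phi>) *v \<phi> = 0" using cliff_square_vec f by blast
  \<comment> \<open>With \<open>q = square_vec \<phi>\<close> and \<open>m = polar_vec \<psi> \<phi>\<close>, these are \<open>q \<psi>\<close>, \<open>m \<psi>\<close> and \<open>m \<phi>\<close>.\<close>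
  moreover define P M N where "P = cliff (square_vec \<phi>) *v \<psi>" and "M = cliff (polar_vec \<psi> \<phi>) *v \<psi>"
    and "N = cliff (polar_vec \<psi> \<phi>) *v \<phi>"
  ultimately have "P + 2 *s (M + N) = 0" "P - 2 *s (M - N) = 0"
    unfolding q cliff_add cliff_diff cliff_scale
    by (simp_all add: matrix_vector_right_distrib matrix_vector_mult_diff_distrib)
  moreover have "4 *s M = (P + 2 *s (M + N)) - (P - 2 *s (M - N))"
    by (simp add: vec_eq_iff algebra_simps)
  ultimately have "4 *s M = 0" by simp
  hence "4 *s (cliff (polar_vec \<psi> \<phi>) *v \<psi>) = 0" by (simp only: M_def)
  thus ?thesis by simp
qed

text \<open>As \<open>C\<close> is a product of five generators, it exchanges the chiralities; so \<open>\<Delta>\<^sup>+\<close> is paired with spinors of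
  the opposite chirality, and the complex conjugate of \<open>C \<xi>\<close> is a legitimate test spinor.\<close>

lemma spinor_pairing_nondegenerate:
  assumes x: "chirality *v \<xi> = - \<xi>" and z: "\<And>\<phi>. \<phi> \<in> \<Delta>_plus \<Longrightarrow> spinor_pairing \<phi> \<xi> = 0"
  shows "\<xi> = 0"
proof -
  define \<phi> :: spinor where "\<phi> = (\<chi> k. cnj ((charge_conj *v \<xi>) $ k))"
  have s: "bit_sign a * bit_sign b * bit_sign c * bit_sign d * bit_sign e * \<xi> $ (a,b,c,d,e) = - \<xi> $ (a,b,c,d,e)" for a b c d e
    using chirality_mv[of \<xi> a b c d e] unfolding x by simp
  have r: "cnj (bit_sign a) = bit_sign a" for a by (simp add: bit_sign_def)
  have "(chirality *v \<phi>) $ (a,b,c,d,e) = \<phi> $ (a,b,c,d,e)" for a b c d e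
    using arg_cong[OF s[of "bit_flip a" "bit_flip b" "bit_flip c" "bit_flip d" "bit_flip e"], of "\<lambda>t. bit_sign b * bit_sign d * cnj t"]
    unfolding chirality_mv \<phi>_def by (simp add: charge_conj_mv r ac_simps)
  hence "\<phi> \<in> \<Delta>_plus" by (simp add: \<Delta>_plus_def vec_eq_iff split_paired_all)
  hence "spinor_pairing \<phi> \<xi> = 0" by (rule z)
  hence "complex_of_real (\<Sum>k\<in>UNIV. (cmod ((charge_conj *v \<xi>) $ k))\<^sup>2) = 0"
    unfolding spinor_pairing_def \<phi>_def by (simp add: complex_norm_square mult.commute del: of_real_power)
  hence "(\<Sum>k\<in>UNIV. (cmod ((charge_conj *v \<xi>) $ k))\<^sup>2) = 0"
    by (simp only: of_real_eq_0_iff)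
  hence "(charge_conj *v \<xi>) $ k = 0" for k
    using sum_nonneg_eq_0_iff[of UNIV "\<lambda>k. (cmod ((charge_conj *v \<xi>) $ k))\<^sup>2"]
    by (simp del: split_paired_All)
  from this[of "(bit_flip a, bit_flip b, bit_flip c, bit_flip d, bit_flip e)" for a b c d e]
  have "bit_sign b * bit_sign d * \<xi> $ (a,b,c,d,e) = 0" for a b c d e
    by (simp add: charge_conj_mv)
  moreover have "bit_sign a \<noteq> 0" for a by (simp add: bit_sign_def)
  ultimately show ?thesis by (simp add: vec_eq_iff split_paired_all)
qed

definition re_vec :: "complex^10 \<Rightarrow> real^10" where "re_vec w = (\<chi> i. Re (w$i))"
definition im_vec :: "complex^10 \<Rightarrow> real^10" where "im_vec w = (\<chi> i. Im (w$i))"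

lemma re_im_vec: "w = cvec (re_vec w) + \<i> *s cvec (im_vec w)"
  by (simp add: vec_eq_iff cvec_def re_vec_def im_vec_def complex_eq_iff)

text \<open>Otherwise some nonzero real \<open>x\<^sub>0\<close> is orthogonal to the real parts of all annihilating vectors, and,
  these vectors being closed under multiplication by \<open>\<i>\<close>, to the vectors themselves.  Applied to the vectors
  \<open>polar_vec \<psi> \<phi>\<close> this says that \<open>x\<^sub>0 \<psi>\<close> is orthogonal to \<open>\<Delta>\<^sup>+\<close>, so that \<open>x\<^sub>0 \<psi> = 0\<close>.\<close>

lemma pure_annihilator_onto_reals:
  assumes p: "pure_spinor \<psi>" and nz: "\<psi> \<noteq> 0"
  shows "\<exists>y. cliff (cvec x + \<i> *s cvec y) *v \<psi> = 0"
proof -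
  define W where "W = {w. cliff w *v \<psi> = 0}"
  have iW: "\<i> *s w \<in> W" if "w \<in> W" for w using that by (simp add: W_def cliff_scale)
  have sub: "subspace (re_vec ` W)"
    unfolding subspace_def
  proof (intro conjI ballI allI)
    show "0 \<in> re_vec ` W" by (rule image_eqI[of _ _ 0]) (simp_all add: W_def cliff_zero re_vec_def vec_eq_iff)
    fix a b assume "a \<in> re_vec ` W" "b \<in> re_vec ` W"
    then obtain u v where "a = re_vec u" "b = re_vec v" "u \<in> W" "v \<in> W" by blast
    thus "a + b \<in> re_vec ` W" by (intro image_eqI[of _ _ "u+v"]) (simp_all add: W_def cliff_add re_vec_def vec_eq_iff)
  next
    fix c :: real and a assume "a \<in> re_vec ` W"
    then obtain u where "a = re_vec u" "u \<in> W" by blast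
    thus "c *\<^sub>R a \<in> re_vec ` W"
      by (intro image_eqI[of _ _ "complex_of_real c *s u"]) (simp_all add: W_def cliff_scale re_vec_def vec_eq_iff)
  qed
  have "re_vec ` W = UNIV"
  proof (rule ccontr)
    assume "re_vec ` W \<noteq> UNIV"
    moreover have "span (re_vec ` W) = re_vec ` W" using sub by (rule span_eq_iff[THEN iffD2])
    ultimately have "span (re_vec ` W) \<noteq> UNIV" by argo
    from span_not_UNIV_orthogonal[OF this] obtain x0
      where x0: "x0 \<noteq> 0" "\<forall>t\<in>span (re_vec ` W). x0 \<bullet> t = 0" by auto
    have orth: "(\<Sum>i\<in>UNIV. cvec x0$i * w$i) = 0" if "w \<in> W" for w
    proof -
      have "x0 \<bullet> re_vec w = 0" "x0 \<bullet> re_vec (\<i> *s w) = 0" using x0(2) iW[OF that] that by (auto intro: span_base)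
      thus ?thesis
        by (simp add: complex_eq_iff cvec_def re_vec_def inner_vec_def sum_negf)
    qed
    have "spinor_pairing \<phi> (cliff (cvec x0) *v \<psi>) = 0" if "\<phi> \<in> \<Delta>_plus" for \<phi>
    proof -
      have "polar_vec \<psi> \<phi> \<in> W" using cliff_polar_vec[OF p that] by (simp add: W_def)
      from orth[OF this] have "spinor_pairing \<psi> (cliff (cvec x0) *v \<phi>) = 0"
        by (simp add: polar_vec_def spinor_pairing_gamma_sum)
      thus ?thesis by (metis spinor_pairing_cliff spinor_pairing_sym)
    qed
    moreover have "chirality *v (cliff (cvec x0) *v \<psi>) = - (cliff (cvec x0) *v \<psi>)"
      using p by (simp add: chirality_cliff pure_spinor_def \<Delta>_plus_def)
    ultimately have "cliff (cvec x0) *v \<psi> = 0" using spinor_pairing_nondegenerate by blast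
    thus False using cliff_cvec_eq_0D nz x0(1) by blast
  qed
  then obtain w where "w \<in> W" "x = re_vec w" by blast
  hence "cliff (cvec x + \<i> *s cvec (im_vec w)) *v \<psi> = 0"
    by (simp only: W_def mem_Collect_eq re_im_vec[symmetric])
  thus ?thesis ..
qed

text \<open>The annihilator is a complex subspace that projects bijectively to its real parts, so it is the graph
  of a real-linear \<open>K\<close>, and stability under \<open>\<i>\<close> means \<open>K\<^sup>2 = -1\<close>.  It is isotropic, because an annihilating vector
  \<open>w\<close> satisfies \<open>w w = w \<cdot> w\<close>; this makes \<open>K\<close> an isometry.\<close>

lemma pure_complex_structure:
  assumes p: "pure_spinor \<psi>" and nz: "\<psi> \<noteq> 0"
  shows "\<exists>K. orthogonal_transformation K \<and> (\<forall>x. K (K x) = - x) \<and>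
    (\<forall>x. cliff (cvec x + \<i> *s cvec (K x)) *v \<psi> = 0)"
proof -
  have "\<forall>x. \<exists>y. cliff (cvec x + \<i> *s cvec y) *v \<psi> = 0"
    using pure_annihilator_onto_reals[OF p nz] by blast
  then obtain K where K: "\<And>x. cliff (cvec x + \<i> *s cvec (K x)) *v \<psi> = 0"
    using choice[of "\<lambda>x y. cliff (cvec x + \<i> *s cvec y) *v \<psi> = 0"] by blast
  have uniq: "y = K x" if "cliff (cvec x + \<i> *s cvec y) *v \<psi> = 0" for x y
  proof -
    have "\<i> *s (cliff (cvec (y - K x)) *v \<psi>) = 0"
    proof -
      have "\<i> *s (cliff (cvec (y - K x)) *v \<psi>) =
        cliff (cvec x + \<i> *s cvec y) *v \<psi> - cliff (cvec x + \<i> *s cvec (K x)) *v \<psi>"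
        unfolding cvec_simps cliff_add cliff_diff cliff_scale by (simp only: vector_ssub_ldistrib add_diff_cancel_left)
      thus ?thesis unfolding that K[of x] by (simp only: diff_self)
    qed
    hence "y - K x = 0" by (intro cliff_cvec_eq_0D[OF _ nz]) (simp only: vector_mul_eq_0 complex_i_not_zero simp_thms)
    thus ?thesis by simp
  qed
  have lin: "linear K"
  proof
    fix x y
    have "cliff (cvec (x+y) + \<i> *s cvec (K x + K y)) *v \<psi> = 0"
      using arg_cong2[OF K[of x] K[of y], of "(+)"] unfolding cliff_add[symmetric]
      by (simp add: cvec_simps vector_add_ldistrib ac_simps)
    thus "K (x + y) = K x + K y" by (rule uniq[symmetric])
  next
    fix r :: real and x
    have "cliff (cvec (r *\<^sub>R x) + \<i> *s cvec (r *\<^sub>R K x)) *v \<psi> = 0"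
      using arg_cong[OF K[of x], of "\<lambda>t. complex_of_real r *s t"] unfolding cliff_scale[symmetric]
      by (simp add: cvec_simps vector_add_ldistrib vector_smult_assoc ac_simps)
    thus "K (r *\<^sub>R x) = r *\<^sub>R K x" by (rule uniq[symmetric])
  qed
  have "K (- K x) = x" for x
  proof -
    have "cvec (- K x) + \<i> *s cvec x = \<i> *s (cvec x + \<i> *s cvec (K x))"
      by (simp add: vec_eq_iff cvec_def algebra_simps)
    hence "cliff (cvec (- K x) + \<i> *s cvec x) *v \<psi> = 0"
      by (simp only: cliff_scale K vector_smult_rzero)
    thus ?thesis by (rule uniq[symmetric])
  qed
  hence KK: "K (K x) = - x" for x using linear_neg[OF lin, of "K x"] by (metis minus_minus)
  have "norm (K x) = norm x" for x
  proof -
    let ?w = "cvec x + \<i> *s cvec (K x)"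
    have "(\<Sum>i\<in>UNIV. ?w$i * ?w$i) *s \<psi> = 0"
      by (simp only: cliff_square[symmetric] K matrix_vector_mult_0_right)
    hence "(\<Sum>i\<in>UNIV. ?w$i * ?w$i) = 0" using nz by simp
    hence "Re (\<Sum>i\<in>UNIV. ?w$i * ?w$i) = 0" by simp
    hence "x \<bullet> x = K x \<bullet> K x" by (simp add: cvec_def inner_vec_def sum_subtractf)
    thus ?thesis by (simp add: norm_eq_sqrt_inner)
  qed
  thus ?thesis using lin KK K by (auto simp: orthogonal_transformation)
qed

section \<open>Lifting orthogonal matrices to the Clifford algebra\<close>

definition reflection_matrix :: "real^'n \<Rightarrow> real^'n^'n" where
  "reflection_matrix u = (\<chi> i j. (if i = j then 1 else 0) - 2 * u$i * u$j)"

lemma reflection_matrix_mv: "reflection_matrix u *v x = x - (2 * (u \<bullet> x)) *\<^sub>R u"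
proof -
  have "(\<Sum>j\<in>UNIV. ((if i = j then 1 else 0) - 2 * u$i * u$j) * x$j) = x$i - 2 * (u \<bullet> x) * u$i" for i
  proof -
    have "(\<Sum>j\<in>UNIV. ((if i = j then 1 else 0) - 2 * u$i * u$j) * x$j)
        = (\<Sum>j\<in>UNIV. (if i = j then x$j else 0)) - (\<Sum>j\<in>UNIV. 2 * u$i * (u$j * x$j))"
      by (subst sum_subtractf[symmetric], rule sum.cong) (auto simp: algebra_simps)
    thus ?thesis by (simp add: inner_vec_def sum_distrib_left[symmetric])
  qed
  thus ?thesis by (simp add: vec_eq_iff reflection_matrix_def matrix_vector_mult_def)
qed

lemma reflection_matrix_involution: "norm u = 1 \<Longrightarrow> reflection_matrix u *v (reflection_matrix u *v x) = x"
  by (simp add: vec_eq_iff reflection_matrix_mv inner_diff_right norm_eq_1 algebra_simps)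

lemma orthogonal_matrix_reflection:
  assumes "norm u = 1" shows "orthogonal_matrix (reflection_matrix u)"
proof -
  have "transpose (reflection_matrix u) = reflection_matrix u"
    by (simp add: transpose_def reflection_matrix_def vec_eq_iff mult.commute eq_commute mult.left_commute)
  moreover have "reflection_matrix u ** reflection_matrix u = mat 1"
    by (simp add: matrix_eq matrix_vector_mul_assoc[symmetric] reflection_matrix_involution[OF assms])
  ultimately show ?thesis by (simp add: orthogonal_matrix)
qed

text \<open>An orthogonal change of basis that takes a coordinate axis to \<open>u\<close> makes the matrix diagonal with a single entry
  \<open>-1\<close>.\<close>

lemma det_reflection:
  fixes u :: "real^'n" assumes "norm u = 1" shows "det (reflection_matrix u) = -1"
proof -
  fix k :: 'n
  obtain Q where Q: "orthogonal_matrix Q" "Q *v axis k 1 = u"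
    using orthogonal_matrix_exists_basis[OF assms] by blast
  have QT: "Q ** transpose Q = mat 1" "transpose Q ** Q = mat 1" using Q(1) by (auto simp: orthogonal_matrix_def)
  have "reflection_matrix u *v x = (Q ** reflection_matrix (axis k 1) ** transpose Q) *v x" for x
  proof -
    have "(axis k 1) \<bullet> (transpose Q *v x) = u \<bullet> x"
      by (metis Q(2) dot_lmul_matrix vector_transpose_matrix transpose_transpose inner_commute)
    moreover have "Q *v (transpose Q *v x) = x" by (simp add: matrix_vector_mul_assoc QT del: transpose_matrix_vector)
    ultimately show ?thesis
      by (simp add: matrix_vector_mul_assoc[symmetric] reflection_matrix_mv matrix_vector_mult_diff_distrib matrix_vector_mult_scaleR Q(2)
          del: transpose_matrix_vector)
  qed
  hence "reflection_matrix u = Q ** reflection_matrix (axis k 1) ** transpose Q" by (simp add: matrix_eq)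
  hence "det (reflection_matrix u) = det (reflection_matrix (axis k (1::real))) * (det Q * det (transpose Q))" by (simp add: det_mul)
  also have "det Q * det (transpose Q) = 1" by (metis QT(1) det_mul det_I)
  also have "det (reflection_matrix (axis k (1::real))) = (\<Prod>i\<in>UNIV. if i = k then -1 else 1)"
  proof (subst det_diagonal)
    show "(\<Prod>i\<in>UNIV. reflection_matrix (axis k (1::real)) $ i $ i) = (\<Prod>i\<in>UNIV. if i = k then -1 else 1)"
      by (rule prod.cong) (auto simp: reflection_matrix_def axis_def)
  qed (auto simp: reflection_matrix_def axis_def)
  finally show ?thesis by simp
qed

text \<open>A product of unit vectors in the Clifford algebra together with the product of the corresponding
  reflections.  An odd number of factors is admitted, so all orthogonal matrices are covered; the
  parity is recorded by the determinant.\<close>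

inductive lifts :: "spin_mat \<Rightarrow> real^10^10 \<Rightarrow> bool" where
  lifts_one: "lifts (mat 1) (mat 1)"
| lifts_step: "norm u = 1 \<Longrightarrow> lifts g A \<Longrightarrow> lifts (cliff (cvec u) ** g) (reflection_matrix u ** A)"

lemma lifts_orthogonal: "lifts g A \<Longrightarrow> orthogonal_matrix A"
  by (induction rule: lifts.induct) (auto simp: orthogonal_matrix_id intro: orthogonal_matrix_mul orthogonal_matrix_reflection)

lemma cliff_unit_square:
  assumes "norm u = 1" shows "cliff (cvec u) ** cliff (cvec u) = mat 1"
  using assms by (simp add: matrix_eq matrix_vector_mul_assoc[symmetric] cliff_cvec_square norm_eq_1)

lemma lifts_invertible: "lifts g A \<Longrightarrow> invertible g"
proof (induction rule: lifts.induct)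
  case lifts_one show ?case unfolding invertible_def by (rule exI[of _ "mat 1"]) simp
next
  case (lifts_step u g A)
  hence "invertible (cliff (cvec u))" unfolding invertible_def using cliff_unit_square by blast
  thus ?case using lifts_step invertible_mult by blast
qed

text \<open>Conjugation by a unit vector is minus the reflection in its orthogonal hyperplane; this sign is the
  origin of the factor \<open>det A\<close> in the two lemmas on conjugation and chirality below.\<close>

lemma cliff_reflect:
  assumes "norm u = 1"
  shows "cliff (cvec u) *v (cliff (cvec y) *v \<psi>) = - (cliff (cvec (reflection_matrix u *v y)) *v (cliff (cvec u) *v \<psi>))"
proof -
  have "cliff (cvec (reflection_matrix u *v y)) *v (cliff (cvec u) *v \<psi>) =
     cliff (cvec y) *v (cliff (cvec u) *v \<psi>) - complex_of_real (2 * (u \<bullet> y)) *s (cliff (cvec u) *v (cliff (cvec u) *v \<psi>))"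
    unfolding reflection_matrix_mv cvec_simps cliff_diff cliff_scale ..
  also have "cliff (cvec u) *v (cliff (cvec u) *v \<psi>) = \<psi>"
    using assms by (simp add: cliff_cvec_square norm_eq_1)
  finally show ?thesis unfolding cliff_cvec_anticomm[of u y] by simp
qed

lemma lifts_twist:
  "lifts g A \<Longrightarrow> g *v (cliff (cvec x) *v \<psi>) =
    complex_of_real (det A) *s (cliff (cvec (A *v x)) *v (g *v \<psi>))"
proof (induction rule: lifts.induct)
  case lifts_one show ?case by simp
next
  case (lifts_step u g A)
  have "(cliff (cvec u) ** g) *v (cliff (cvec x) *v \<psi>)
      = complex_of_real (det A) *s (cliff (cvec u) *v (cliff (cvec (A *v x)) *v (g *v \<psi>)))"
    unfolding matrix_vector_mul_assoc[symmetric, of "cliff (cvec u)"] lifts_step.IH vector_scalar_commute ..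
  also have "\<dots> = complex_of_real (det A) *s (- (cliff (cvec (reflection_matrix u *v (A *v x))) *v (cliff (cvec u) *v (g *v \<psi>))))"
    unfolding cliff_reflect[OF lifts_step.hyps(1)] ..
  finally show ?case
    by (simp add: det_mul det_reflection[OF lifts_step.hyps(1)] matrix_vector_mul_assoc[symmetric] vec_eq_iff)
qed

lemma lifts_chirality:
  "lifts g A \<Longrightarrow> chirality *v (g *v \<psi>) = complex_of_real (det A) *s (g *v (chirality *v \<psi>))"
proof (induction rule: lifts.induct)
  case lifts_one show ?case by simp
next
  case (lifts_step u g A)
  thus ?case
    by (simp add: det_mul det_reflection matrix_vector_mul_assoc[symmetric] chirality_cliff vector_scalar_commute vec.scale_minus_left)
qed

text \<open>For a unit vector \<open>u\<close>, self-adjointness moves one \<open>u\<close> across the pairing, and \<open>u v u\<close> is again a vector.\<close>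

lemma lifts_null_spinor:
  "lifts g A \<Longrightarrow> \<forall>v. spinor_pairing \<psi> (cliff v *v \<psi>) = 0
    \<Longrightarrow> spinor_pairing (g *v \<psi>) (cliff v *v (g *v \<psi>)) = 0"
proof (induction arbitrary: v rule: lifts.induct)
  case lifts_one thus ?case by simp
next
  case (lifts_step u g A)
  let ?c = "cliff (cvec u)" and ?\<xi> = "g *v \<psi>"
  have "?c *v (cliff v *v (?c *v ?\<xi>)) =
      (2 * (\<Sum>i\<in>UNIV. cvec u$i * v$i)) *s (?c *v ?\<xi>) - cliff v *v (?c *v (?c *v ?\<xi>))"
    using cliff_anticomm[of "cvec u" v "?c *v ?\<xi>"] by (simp add: eq_diff_eq)
  moreover have "?c *v (?c *v ?\<xi>) = ?\<xi>"
    using lifts_step.hyps(1) by (simp add: cliff_cvec_square norm_eq_1)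
  ultimately show ?case
    using lifts_step.IH[OF lifts_step.prems] by (simp add: matrix_vector_mul_assoc[symmetric] spinor_pairing_cliff spinor_pairing_linear)
qed

lemma orthogonal_matrix_inner:
  fixes A :: "real^'n^'n"
  assumes "orthogonal_matrix A" shows "(A *v x) \<bullet> (A *v y) = x \<bullet> y"
  using assms by (metis matrix_of_matrix_vector_mul matrix_vector_mul_linear orthogonal_transformation_def orthogonal_transformation_matrix)

text \<open>The Cartan-Dieudonne theorem, by induction on the set of coordinate axes that may be moved: the
  reflection in the direction of \<open>A e\<^sub>i - e\<^sub>i\<close> takes \<open>A e\<^sub>i\<close> back to \<open>e\<^sub>i\<close> and does not disturb the axes that are
  already fixed.\<close>

lemma orthogonal_fixing_complement_lifts:
  assumes "finite T"
  shows "orthogonal_matrix A \<Longrightarrow> \<forall>j. j \<notin> T \<longrightarrow> A *v axis j 1 = axis j 1 \<Longrightarrow> \<exists>g. lifts g A"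
  using assms
proof (induction T arbitrary: A rule: finite_induct)
  case empty
  hence "column j A = axis j 1" for j by (simp add: matrix_vector_mult_basis)
  hence "A $ i $ j = axis j 1 $ i" for i j by (metis (no_types) column_def vec_lambda_beta)
  hence "A = mat 1" by (simp add: vec_eq_iff mat_def axis_def eq_commute)
  thus ?case using lifts_one by blast
next
  case (insert i T)
  show ?case
  proof (cases "A *v axis i 1 = axis i 1")
    case True
    hence "\<forall>j. j \<notin> T \<longrightarrow> A *v axis j 1 = axis j 1" using insert.prems(2) by (metis insert_iff)
    thus ?thesis by (rule insert.IH[OF insert.prems(1)])
  next
    case False
    define d where "d = A *v axis i 1 - axis i 1"
    define u where "u = d /\<^sub>R norm d"
    have nd: "norm d \<noteq> 0" using False by (simp add: d_def)
    hence nu: "norm u = 1" by (simp add: u_def)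
    have dot: "(A *v x) \<bullet> (A *v y) = x \<bullet> y" for x y
      by (rule orthogonal_matrix_inner[OF insert.prems(1)])
    have "2 * (d \<bullet> (A *v axis i 1)) = d \<bullet> d"
      unfolding d_def by (simp add: inner_diff_left inner_diff_right dot inner_commute)
    hence "2 * (u \<bullet> (A *v axis i 1)) = norm d"
      using nd by (simp add: u_def field_simps power2_norm_eq_inner[symmetric] power2_eq_square)
    hence ri: "reflection_matrix u *v (A *v axis i 1) = axis i 1"
      using nd by (simp add: reflection_matrix_mv u_def d_def)
    have rj: "reflection_matrix u *v (A *v axis j 1) = axis j 1" if "j \<notin> insert i T" for j
    proof -
      have Aj: "A *v axis j 1 = axis j 1" using insert.prems(2) that by blast
      have "(A *v axis i 1) \<bullet> axis j 1 = 0" using dot[of "axis i 1" "axis j 1"] that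
        by (auto simp: Aj inner_axis_axis)
      hence "d \<bullet> axis j 1 = 0" using that by (auto simp: d_def inner_diff_left inner_axis_axis)
      thus ?thesis by (simp add: Aj reflection_matrix_mv u_def)
    qed
    have "orthogonal_matrix (reflection_matrix u ** A)"
      using nu insert.prems(1) orthogonal_matrix_mul orthogonal_matrix_reflection by blast
    moreover have "\<forall>j. j \<notin> T \<longrightarrow> (reflection_matrix u ** A) *v axis j 1 = axis j 1"
      using ri rj by (metis insert_iff matrix_vector_mul_assoc)
    ultimately obtain g where "lifts g (reflection_matrix u ** A)" using insert.IH by blast
    from lifts_step[OF nu this] show ?thesis
      by (metis matrix_mul_assoc matrix_mul_lid reflection_matrix_involution[OF nu] matrix_eq matrix_vector_mul_assoc matrix_vector_mul_lid)
  qed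
qed

lemma orthogonal_matrix_lifts: "orthogonal_matrix A \<Longrightarrow> \<exists>g. lifts g A"
  using orthogonal_fixing_complement_lifts[of UNIV A] by simp

lemma Spin10_lifts: "g \<in> Spin10 \<Longrightarrow> \<exists>A. lifts g A \<and> det A = 1"
proof (induction rule: Spin10.induct)
  case Spin10_one thus ?case using lifts_one by auto
next
  case (Spin10_step u w g)
  then obtain A where "lifts g A" "det A = 1" by blast
  hence "lifts (cliff (cvec u) ** (cliff (cvec w) ** g)) (reflection_matrix u ** (reflection_matrix w ** A))"
    using Spin10_step lifts_step by blast
  thus ?case using \<open>det A = 1\<close> Spin10_step
    by (metis det_mul det_reflection matrix_mul_assoc minus_mult_minus mult_1)
qed

lemma vec_rep_lifts:
  assumes "lifts g A" "det A = 1" shows "vec_rep g = A"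
  unfolding vec_rep_def
proof (rule the_equality)
  have inv: "g ** matrix_inv g = mat 1" "matrix_inv g ** g = mat 1"
    using someI_ex[OF lifts_invertible[OF assms(1), unfolded invertible_def]] by (simp_all add: matrix_inv_def)
  have "g ** cliff (cvec u) = cliff (cvec (A *v u)) ** g" for u
    by (simp add: matrix_eq matrix_vector_mul_assoc[symmetric] lifts_twist[OF assms(1)] assms(2))
  hence "g ** cliff (cvec u) ** matrix_inv g = cliff (cvec (A *v u))" for u
    by (simp add: matrix_mul_assoc[symmetric] inv)
  thus A: "\<forall>u. cliff (cvec (A *v u)) = g ** cliff (cvec u) ** matrix_inv g" by simp
  fix B assume B: "\<forall>u. cliff (cvec (B *v u)) = g ** cliff (cvec u) ** matrix_inv g"
  have "B *v u = A *v u" for u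
  proof -
    have "cliff (cvec (B *v u)) = cliff (cvec (A *v u))" using A B by simp
    hence "cliff (cvec (B *v u - A *v u)) *v axis (1,1,1,1,1) 1 = 0" by (simp add: cvec_simps cliff_diff)
    thus ?thesis using cliff_cvec_eq_0D[of "B *v u - A *v u" "axis (1,1,1,1,1) 1"] by (simp add: axis_eq_0_iff)
  qed
  thus "B = A" by (simp add: matrix_eq)
qed

section \<open>Complex structures and unitary frames\<close>

text \<open>Multiplication by \<open>\<i>\<close> under the identification \<open>to_C5\<close>.\<close>

definition times_i :: "real^10 \<Rightarrow> real^10" where
  "times_i x = vector [- x$2, x$1, - x$4, x$3, - x$6, x$5, - x$8, x$7, - x$10, x$9]"

lemma times_i_nth:
  "times_i x$1 = - x$2" "times_i x$2 = x$1" "times_i x$3 = - x$4" "times_i x$4 = x$3" "times_i x$5 = - x$6"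
  "times_i x$6 = x$5" "times_i x$7 = - x$8" "times_i x$8 = x$7" "times_i x$9 = - x$10" "times_i x$10 = x$9"
  by (simp_all add: times_i_def vector_10)

lemma all_10: "(\<forall>i::10. P i) \<longleftrightarrow> P 1 \<and> P 2 \<and> P 3 \<and> P 4 \<and> P 5 \<and> P 6 \<and> P 7 \<and> P 8 \<and> P 9 \<and> P 10"
  using exhaust_10 by metis

text \<open>Gram-Schmidt over the complex numbers, expressed in real terms.  The span of the vectors chosen so far
  and their images under \<open>K\<close> is \<open>K\<close>-invariant, so a unit vector orthogonal to it also has its image under
  \<open>K\<close> orthogonal to it.\<close>

lemma orthonormal_complex_frame:
  fixes K :: "'a::euclidean_space \<Rightarrow> 'a"
  assumes K: "orthogonal_transformation K" "\<And>x. K (K x) = - x"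
  shows "2 * n \<le> DIM('a) \<Longrightarrow> \<exists>f. \<forall>j<n. \<forall>k<n. f j \<bullet> f k = (if j = k then 1 else 0) \<and> f j \<bullet> K (f k) = 0"
proof (induction n)
  case 0 show ?case by simp
next
  case (Suc n)
  then obtain f where f: "\<And>j k. j < n \<Longrightarrow> k < n \<Longrightarrow> f j \<bullet> f k = (if j = k then 1 else 0) \<and> f j \<bullet> K (f k) = 0"
    by auto
  have KK: "K x \<bullet> K y = x \<bullet> y" for x y using K(1) by (simp add: orthogonal_transformation_def)
  have skew: "x \<bullet> K y = - (K x \<bullet> y)" for x y using KK[of x "K y"] K(2) by simp
  have skew0: "x \<bullet> K x = 0" for x using skew[of x x] by (simp add: inner_commute)
  define S where "S = f ` {..<n} \<union> (\<lambda>k. K (f k)) ` {..<n}"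
  have "card S \<le> card (f ` {..<n}) + card ((\<lambda>k. K (f k)) ` {..<n})" unfolding S_def by (rule card_Un_le)
  also have "\<dots> \<le> n + n" using card_image_le[of "{..<n}"] by (metis add_mono card_lessThan finite_lessThan)
  also have "\<dots> < DIM('a)" using Suc.prems by simp
  finally have "card S < DIM('a)" .
  moreover have "finite S" by (simp add: S_def)
  ultimately have "dim S < DIM('a)" using dim_le_card'[of S] by linarith
  hence "span S \<noteq> UNIV" by (metis dim_span dim_UNIV less_irrefl)
  from span_not_UNIV_orthogonal[OF this] obtain a where a: "a \<noteq> 0" "\<forall>x\<in>span S. a \<bullet> x = 0" by auto
  define b where "b = a /\<^sub>R norm a"
  have bb: "b \<bullet> b = 1" using a(1) by (simp add: b_def power2_norm_eq_inner[symmetric] power2_eq_square field_simps)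
  have bf: "b \<bullet> f k = 0" "b \<bullet> K (f k) = 0" if "k < n" for k
    using a(2) that by (auto simp: b_def S_def intro!: span_base)
  have fb: "f k \<bullet> b = 0" "f k \<bullet> K b = 0" if "k < n" for k
    using bf[OF that] skew[of "f k" b] by (simp_all add: inner_commute)
  show ?case
  proof (rule exI[of _ "f(n := b)"], intro allI impI)
    fix j k assume "j < Suc n" "k < Suc n"
    thus "(f(n := b)) j \<bullet> (f(n := b)) k = (if j = k then 1 else 0) \<and> (f(n := b)) j \<bullet> K ((f(n := b)) k) = 0"
      using f[of j k] bb bf fb skew0 by (auto simp: less_Suc_eq)
  qed
qed

lemma complex_structure_conjugate_times_i:
  assumes K: "orthogonal_transformation K" "\<And>x. K (K x) = - x"
  shows "\<exists>A. orthogonal_matrix A \<and> (\<forall>x. A *v times_i x = K (A *v x))"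
proof -
  obtain f where f0: "\<And>j k. j < (5::nat) \<Longrightarrow> k < 5 \<Longrightarrow> f j \<bullet> f k = (if j = k then 1 else 0)"
    and f1: "\<And>j k. j < (5::nat) \<Longrightarrow> k < 5 \<Longrightarrow> f j \<bullet> K (f k) = 0"
    using orthonormal_complex_frame[OF K, of 5] by auto
  have KK: "K x \<bullet> K y = x \<bullet> y" for x y using K(1) by (simp add: orthogonal_transformation_def)
  have linK: "linear K" using K(1) by (simp add: orthogonal_transformation_def)
  define F where "F x = x$1 *\<^sub>R f 0 + x$2 *\<^sub>R K (f 0) + x$3 *\<^sub>R f 1 + x$4 *\<^sub>R K (f 1) + x$5 *\<^sub>R f 2 + x$6 *\<^sub>R K (f 2)
     + x$7 *\<^sub>R f 3 + x$8 *\<^sub>R K (f 3) + x$9 *\<^sub>R f 4 + x$10 *\<^sub>R K (f 4)" for x :: "real^10"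
  have lin: "linear F" by (rule linearI) (simp_all add: F_def algebra_simps)
  have f2: "K (f k) \<bullet> f j = 0" if "j < 5" "k < 5" for j k using f1[OF that] by (simp add: inner_commute)
  have "F x \<bullet> F y = x$1 * y$1 + x$2 * y$2 + x$3 * y$3 + x$4 * y$4 + x$5 * y$5
      + x$6 * y$6 + x$7 * y$7 + x$8 * y$8 + x$9 * y$9 + x$10 * y$10" for x y
    unfolding F_def by (simp add: inner_add_left inner_add_right KK f0 f1 f2)
  hence "F x \<bullet> F y = x \<bullet> y" for x y by (simp add: inner_vec_def sum_10)
  hence "orthogonal_transformation F" using lin by (simp add: orthogonal_transformation_def)
  hence "orthogonal_matrix (matrix F)" by (simp add: orthogonal_transformation_matrix)
  moreover have "matrix F *v times_i x = K (matrix F *v x)" for x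
    by (simp add: matrix_works lin linear_matrix_vector_mul_eq F_def times_i_nth linear_add[OF linK] linear_scale[OF linK] K(2))
  ultimately show ?thesis by blast
qed

section \<open>The spinor line of an orthogonal matrix\<close>

text \<open>The joint kernel of the annihilation operators for the complex structure transported by \<open>A\<close>.\<close>

definition fock_line :: "real^10^10 \<Rightarrow> spinor set" where
  "fock_line A = {\<psi>. \<forall>x. cliff (cvec (A *v x) + \<i> *s cvec (A *v times_i x)) *v \<psi> = 0}"

definition vacuum :: spinor where "vacuum = axis (1,1,1,1,1) 1"

lemma cliff_vacuum:
  "cliff (cvec x + \<i> *s cvec (times_i x)) *v vacuum = 0"
proof -
  have c: "a = 1 \<or> a = 2" for a :: 2 by (rule exhaust_2)
  have "(cliff (cvec x + \<i> *s cvec (times_i x)) *v vacuum) $ (a,b,c,d,e) = 0" for a b c d e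
    unfolding cliff_mv
    using c[of a] c[of b] c[of c] c[of d] c[of e]
    by (elim disjE) (simp_all add: vacuum_def axis_def cvec_def times_i_nth algebra_simps)
  thus ?thesis by (simp add: vec_eq_iff split_paired_all)
qed

text \<open>The annihilation operator of the \<open>k\<close>-th bit forces every component whose \<open>k\<close>-th bit is flipped to vanish.\<close>

lemma annihilated_by_std_imp_vacuum:
  assumes "\<And>x. cliff (cvec x + \<i> *s cvec (times_i x)) *v \<psi> = 0"
  shows "\<psi> = (\<psi> $ (1,1,1,1,1)) *s vacuum"
proof -
  have c: "a = 1 \<or> a = 2" for a :: 2 by (rule exhaust_2)
  have eq: "(cliff (cvec x + \<i> *s cvec (times_i x)) *v \<psi>) $ (a,b,c,d,e) = 0" for x a b c d e
    by (simp add: assms)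
  \<comment> \<open>The equations read off in coordinates, to be used for the basis vectors of odd number and an unflipped bit.\<close>
  note E = eq[unfolded cliff_mv, simplified cvec_def vec_lambda_beta plus_vec_def vector_scalar_mult_def times_i_nth]
  have s: "bit_sign a = 1 \<or> bit_sign a = -1" for a by (simp add: bit_sign_def)
  have 1: "\<psi> $ (2,b,c,d,e) = 0" for b c d e
    using E[of "axis 1 1" 1 b c d e] by (simp add: axis_def)
  have 2: "\<psi> $ (a,2,c,d,e) = 0" for a c d e
    using E[of "axis 3 1" a 1 c d e] s[of a] by (auto simp add: axis_def)
  have 3: "\<psi> $ (a,b,2,d,e) = 0" for a b d e
    using E[of "axis 5 1" a b 1 d e] s[of a] s[of b] by (auto simp add: axis_def)
  have 4: "\<psi> $ (a,b,c,2,e) = 0" for a b c e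
    using E[of "axis 7 1" a b c 1 e] s[of a] s[of b] s[of c] by (auto simp add: axis_def)
  have 5: "\<psi> $ (a,b,c,d,2) = 0" for a b c d
    using E[of "axis 9 1" a b c d 1] s[of a] s[of b] s[of c] s[of d] by (auto simp add: axis_def)
  have "\<psi> $ (a,b,c,d,e) = (\<psi> $ (1,1,1,1,1) *s vacuum) $ (a,b,c,d,e)" for a b c d e
    using c[of a] c[of b] c[of c] c[of d] c[of e]
    by (elim disjE) (simp_all add: vacuum_def axis_def 1 2 3 4 5)
  thus ?thesis unfolding vec_eq_iff split_paired_All by blast
qed

lemma fock_line_std: "fock_line (mat 1) = range (\<lambda>c. c *s vacuum)"
proof
  show "fock_line (mat 1) \<subseteq> range (\<lambda>c. c *s vacuum)"
    using annihilated_by_std_imp_vacuum by (auto simp: fock_line_def)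
  show "range (\<lambda>c. c *s vacuum) \<subseteq> fock_line (mat 1)"
    using cliff_vacuum by (auto simp: fock_line_def vector_scalar_commute)
qed

lemma lifts_twist_complex:
  assumes "lifts g B"
  shows "g *v (cliff (cvec x + \<i> *s cvec y) *v \<psi>)
    = complex_of_real (det B) *s (cliff (cvec (B *v x) + \<i> *s cvec (B *v y)) *v (g *v \<psi>))"
  by (simp add: cliff_add cliff_scale matrix_vector_right_distrib vector_scalar_commute lifts_twist[OF assms]
      vector_add_ldistrib vector_smult_assoc mult.commute)

lemma fock_line_lifts:
  assumes g: "lifts g B"
  shows "fock_line (B ** A) = (*v) g ` fock_line A"
proof -
  have d: "complex_of_real (det B) \<noteq> 0"
    using det_orthogonal_matrix[OF lifts_orthogonal[OF g]] by auto
  obtain h where h: "g ** h = mat 1" "h ** g = mat 1" using lifts_invertible[OF g] by (auto simp: invertible_def)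
  have hg: "h *v (g *v x) = x" "g *v (h *v x) = x" for x by (simp_all add: matrix_vector_mul_assoc h)
  have "g *v \<psi> \<in> fock_line (B ** A) \<longleftrightarrow> \<psi> \<in> fock_line A" for \<psi>
  proof -
    have "cliff (cvec (B *v (A *v x)) + \<i> *s cvec (B *v (A *v times_i x))) *v (g *v \<psi>) = 0
        \<longleftrightarrow> cliff (cvec (A *v x) + \<i> *s cvec (A *v times_i x)) *v \<psi> = 0" (is "?L = 0 \<longleftrightarrow> ?R = 0") for x
    proof -
      have "?L = 0 \<longleftrightarrow> g *v ?R = 0" using d by (simp add: lifts_twist_complex[OF g])
      also have "\<dots> \<longleftrightarrow> ?R = 0" using hg(1)[of ?R] by (metis matrix_vector_mult_0_right)
      finally show ?thesis .
    qed
    thus ?thesis by (simp add: fock_line_def matrix_vector_mul_assoc[symmetric])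
  qed
  note mem = this
  show ?thesis
  proof
    show "fock_line (B ** A) \<subseteq> (*v) g ` fock_line A"
    proof
      fix \<psi> assume "\<psi> \<in> fock_line (B ** A)"
      hence "h *v \<psi> \<in> fock_line A" using mem[of "h *v \<psi>"] hg(2) by simp
      thus "\<psi> \<in> (*v) g ` fock_line A" by (rule image_eqI[rotated]) (simp add: hg(2))
    qed
    show "(*v) g ` fock_line A \<subseteq> fock_line (B ** A)" using mem by blast
  qed
qed

lemma fock_line_lifts_vacuum:
  assumes "lifts g A" shows "fock_line A = range (\<lambda>c. c *s (g *v vacuum))" "g *v vacuum \<noteq> 0"
proof -
  show "fock_line A = range (\<lambda>c. c *s (g *v vacuum))"
    using fock_line_lifts[OF assms, of "mat 1"] by (simp add: fock_line_std image_image vector_scalar_commute)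
  obtain h where "h ** g = mat 1" using lifts_invertible[OF assms] by (auto simp: invertible_def)
  hence "h *v (g *v vacuum) = vacuum" by (simp add: matrix_vector_mul_assoc)
  thus "g *v vacuum \<noteq> 0" by (metis axis_eq_0_iff matrix_vector_mult_0_right vacuum_def zero_neq_one)
qed

lemma chirality_vacuum: "chirality *v vacuum = vacuum"
proof -
  have c: "a = 1 \<or> a = 2" for a :: 2 by (rule exhaust_2)
  have "(chirality *v vacuum) $ (a,b,c,d,e) = vacuum $ (a,b,c,d,e)" for a b c d e
    using c[of a] c[of b] c[of c] c[of d] c[of e]
    by (elim disjE) (simp_all add: chirality_mv vacuum_def axis_def)
  thus ?thesis unfolding vec_eq_iff split_paired_All by blast
qed

lemma vacuum_null: "spinor_pairing vacuum (cliff v *v vacuum) = 0"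
  by (simp add: spinor_pairing_def sum_spinor sum_2 charge_conj_mv cliff_mv vacuum_def axis_def)

lemma SO10_lifts: "A \<in> SO10 \<Longrightarrow> \<exists>g. lifts g A \<and> det A = 1"
  using orthogonal_matrix_lifts by (auto simp: SO10_def)

lemma fock_line_SO10:
  assumes "A \<in> SO10"
  obtains \<psi> where "fock_line A = range (\<lambda>c. c *s \<psi>)" "\<psi> \<noteq> 0" "pure_spinor \<psi>"
proof -
  obtain g where g: "lifts g A" "det A = 1" using SO10_lifts[OF assms] by blast
  have "pure_spinor (g *v vacuum)"
    using lifts_null_spinor[OF g(1)] vacuum_null lifts_chirality[OF g(1), of vacuum] g(2)
    by (simp add: pure_spinor_iff_pairing \<Delta>_plus_def chirality_vacuum)
  thus thesis using that fock_line_lifts_vacuum[OF g(1)] by blast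
qed

text \<open>Every orthogonal complex structure is conjugate to the standard one under \<open>O(10)\<close>; the chirality of \<open>\<psi>\<close>
  is what singles out conjugation by \<open>SO(10)\<close>.\<close>

lemma pure_spinor_in_fock_line:
  assumes p: "pure_spinor \<psi>" and nz: "\<psi> \<noteq> 0"
  shows "\<exists>A\<in>SO10. \<psi> \<in> fock_line A"
proof -
  obtain K where K: "orthogonal_transformation K" "\<And>x. K (K x) = - x" "\<And>x. cliff (cvec x + \<i> *s cvec (K x)) *v \<psi> = 0"
    using pure_complex_structure[OF assms] by blast
  obtain A where A: "orthogonal_matrix A" "\<And>x. A *v times_i x = K (A *v x)"
    using complex_structure_conjugate_times_i[OF K(1,2)] by blast
  have mem: "\<psi> \<in> fock_line A" by (simp add: fock_line_def A(2) K(3))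
  obtain g where g: "lifts g A" using orthogonal_matrix_lifts[OF A(1)] by blast
  obtain c where c: "\<psi> = c *s (g *v vacuum)" using mem fock_line_lifts_vacuum[OF g] by blast
  \<comment> \<open>An orientation-reversing \<open>A\<close> would put \<open>\<psi>\<close> into the opposite chirality.\<close>
  have "\<psi> = chirality *v \<psi>" using p by (simp add: pure_spinor_def \<Delta>_plus_def)
  also have "\<dots> = complex_of_real (det A) *s \<psi>"
    by (simp add: c vector_scalar_commute lifts_chirality[OF g] chirality_vacuum vector_smult_assoc mult.commute)
  finally have "(1 - complex_of_real (det A)) *s \<psi> = 0" by (simp add: vector_ssub_ldistrib vec.scale_left_diff_distrib)
  hence "1 - complex_of_real (det A) = 0" using nz vector_mul_eq_0 by blast
  hence "det A = 1" by simp
  thus ?thesis using A(1) mem by (auto simp: SO10_def)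
qed

section \<open>Cosets of U(5)\<close>

lemma vector_5:
  "(vector [a,b,c,d,e] :: 'a::zero^5)$1 = a"
  "(vector [a,b,c,d,e] :: 'a::zero^5)$2 = b"
  "(vector [a,b,c,d,e] :: 'a::zero^5)$3 = c"
  "(vector [a,b,c,d,e] :: 'a::zero^5)$4 = d"
  "(vector [a,b,c,d,e] :: 'a::zero^5)$5 = e"
  unfolding vector_def by simp_all

lemma exhaust_5: fixes x :: 5 shows "x=1\<or>x=2\<or>x=3\<or>x=4\<or>x=5"
proof (induct x)
  case (of_int z)
  hence "z = 0 \<or> z = 1 \<or> z = 2 \<or> z = 3 \<or> z = 4"
    by simp presburger
  thus ?case by auto
qed

lemma all_5: "(\<forall>i::5. P i) \<longleftrightarrow> P 1 \<and> P 2 \<and> P 3 \<and> P 4 \<and> P 5"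
  using exhaust_5 by metis

lemma UNIV_5: "UNIV = {1,2,3,4,5::5}"
  using exhaust_5 by blast

lemma sum_5: "sum f (UNIV::5 set) = f 1 + f 2 + f 3 + f 4 + f 5"
  unfolding UNIV_5 by (simp add: ac_simps)

lemma to_C5_nth:
  "to_C5 x$1 = Complex (x$1) (x$2)" "to_C5 x$2 = Complex (x$3) (x$4)" "to_C5 x$3 = Complex (x$5) (x$6)"
  "to_C5 x$4 = Complex (x$7) (x$8)" "to_C5 x$5 = Complex (x$9) (x$10)"
  by (simp_all add: to_C5_def vector_5)

lemma to_C5_times_i: "to_C5 (times_i x) = \<i> *s to_C5 x"
  by (simp add: vec_eq_iff all_5 to_C5_nth times_i_nth complex_eq_iff)

lemma to_C5_inj: "to_C5 x = to_C5 y \<longleftrightarrow> x = y"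
  by (auto simp add: vec_eq_iff all_5 all_10 to_C5_nth)

lemma to_C5_add: "to_C5 (x + y) = to_C5 x + to_C5 y"
  and to_C5_scaleR: "to_C5 (r *\<^sub>R x) = complex_of_real r *s to_C5 x"
  by (simp_all add: vec_eq_iff all_5 to_C5_nth complex_eq_iff)

text \<open>The real inner product and \<open>J\<close> together determine the Hermitian form.  Hence an orthogonal matrix that
  commutes with \<open>J\<close> is unitary.\<close>

lemma to_C5_hermitian:
  "(\<Sum>k\<in>UNIV. cnj (to_C5 x$k) * to_C5 y$k) = Complex (x \<bullet> y) (- (x \<bullet> times_i y))"
  by (simp add: complex_eq_iff sum_5 to_C5_nth inner_vec_def sum_10 times_i_nth)

definition cplx_axis :: "5 \<Rightarrow> real^10" where
  "cplx_axis k = (if k = 1 then axis 1 1 else if k = 2 then axis 3 1 else if k = 3 then axis 5 1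
     else if k = 4 then axis 7 1 else axis 9 1)"

lemma to_C5_cplx_axis: "to_C5 (cplx_axis k) = axis k 1"
  by (simp add: vec_eq_iff all_5 to_C5_nth cplx_axis_def axis_def complex_eq_iff) (use exhaust_5[of k] in auto)

lemma cplx_axis_expand:
  "x = (\<Sum>k\<in>UNIV. Re (to_C5 x$k) *\<^sub>R cplx_axis k + Im (to_C5 x$k) *\<^sub>R times_i (cplx_axis k))"
  by (simp add: vec_eq_iff all_10 sum_5 to_C5_nth cplx_axis_def axis_def times_i_nth)

lemma U5_commutes: "h \<in> U5 \<Longrightarrow> h *v times_i x = times_i (h *v x)"
proof -
  assume "h \<in> U5"
  then obtain B where B: "\<And>x. to_C5 (h *v x) = B *v to_C5 x" by (auto simp: U5_def)
  have "to_C5 (h *v times_i x) = to_C5 (times_i (h *v x))"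
    by (simp add: B to_C5_times_i vector_scalar_commute)
  thus ?thesis by (simp add: to_C5_inj)
qed

text \<open>Commuting with \<open>J\<close> makes \<open>h\<close> complex linear on \<open>\<complex>\<^sup>5\<close>, so it is given by the matrix whose columns are the
  images of the basis vectors.\<close>

lemma orthogonal_commutes_U5:
  assumes h: "orthogonal_matrix h" and c: "\<And>x. h *v times_i x = times_i (h *v x)"
  shows "h \<in> U5"
proof -
  define B :: "complex^5^5" where "B = (\<chi> i j. to_C5 (h *v cplx_axis j) $ i)"
  have act: "to_C5 (h *v x) = B *v to_C5 x" for x
  proof -
    have hx: "h *v x = (\<Sum>k\<in>UNIV. Re (to_C5 x$k) *\<^sub>R (h *v cplx_axis k) + Im (to_C5 x$k) *\<^sub>R times_i (h *v cplx_axis k))"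
      by (subst cplx_axis_expand[of x])
         (simp add: sum_5 matrix_vector_right_distrib matrix_vector_mult_scaleR c)
    have "to_C5 (h *v x) = (\<Sum>k\<in>UNIV. complex_of_real (Re (to_C5 x$k)) *s to_C5 (h *v cplx_axis k)
        + complex_of_real (Im (to_C5 x$k)) *s (\<i> *s to_C5 (h *v cplx_axis k)))"
      unfolding hx by (simp only: sum_5 to_C5_add to_C5_scaleR to_C5_times_i)
    also have "\<dots> = (\<Sum>k\<in>UNIV. to_C5 x$k *s to_C5 (h *v cplx_axis k))"
      by (rule sum.cong) (simp_all add: vec_eq_iff complex_eq_iff)
    finally have "to_C5 (h *v x) = (\<Sum>k\<in>UNIV. to_C5 x$k *s to_C5 (h *v cplx_axis k))" .
    thus ?thesis by (simp add: vec_eq_iff matrix_vector_mult_def B_def mult.commute)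
  qed
  have dot: "(h *v x) \<bullet> (h *v y) = x \<bullet> y" for x y
    by (rule orthogonal_matrix_inner[OF h])
  have herm: "(\<Sum>k\<in>UNIV. cnj (B$k$i) * B$k$j) = (if i = j then 1 else 0)" for i j
  proof -
    have "(\<Sum>k\<in>UNIV. cnj (B$k$i) * B$k$j) = (\<Sum>k\<in>UNIV. cnj (to_C5 (cplx_axis i)$k) * to_C5 (cplx_axis j)$k)"
      by (simp add: B_def to_C5_hermitian c[symmetric] dot)
    thus ?thesis by (simp add: to_C5_cplx_axis axis_def if_distrib[of cnj] if_distrib[of "\<lambda>t. t * _"] cong: if_cong)
  qed
  have "(\<chi> i j. cnj (B$j$i)) ** B = mat 1"
    by (simp add: vec_eq_iff matrix_matrix_mult_def herm mat_def)
  moreover from this have "B ** (\<chi> i j. cnj (B$j$i)) = mat 1"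
    using matrix_left_right_inverse by blast
  ultimately show ?thesis unfolding U5_def unitary_matrix_def using act by blast
qed

lemma U5_one: "mat 1 \<in> U5"
  by (rule orthogonal_commutes_U5) (simp_all add: orthogonal_matrix_id)

lemma U5_mult: "g \<in> U5 \<Longrightarrow> h \<in> U5 \<Longrightarrow> g ** h \<in> U5"
proof -
  assume "g \<in> U5" "h \<in> U5"
  then obtain B C where B: "unitary_matrix B" "\<And>x. to_C5 (g *v x) = B *v to_C5 x"
    and C: "unitary_matrix C" "\<And>x. to_C5 (h *v x) = C *v to_C5 x"
    unfolding U5_def by blast
  let ?ad = "\<lambda>B :: complex^5^5. (\<chi> i j. cnj (B$j$i)) :: complex^5^5"
  have ad: "?ad (B ** C) = ?ad C ** ?ad B"
    by (simp add: vec_eq_iff matrix_matrix_mult_def mult.commute)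
  have "?ad (B ** C) ** (B ** C) = ?ad C ** (?ad B ** B) ** C"
    unfolding ad by (simp add: matrix_mul_assoc)
  moreover have "(B ** C) ** ?ad (B ** C) = B ** (C ** ?ad C) ** ?ad B"
    unfolding ad by (simp add: matrix_mul_assoc)
  ultimately have "unitary_matrix (B ** C)"
    using B(1) C(1) by (simp add: unitary_matrix_def)
  moreover have "to_C5 ((g ** h) *v x) = (B ** C) *v to_C5 x" for x
    by (simp add: matrix_vector_mul_assoc[symmetric] B C)
  ultimately show ?thesis unfolding U5_def by blast
qed

text \<open>If one spinor is killed by both \<open>A x + \<i> A J x\<close> and \<open>B y + \<i> B J y\<close>, where \<open>y\<close> is chosen with
  \<open>B y = A x\<close>, then the difference of the imaginary parts is a real vector that kills it, hence zero.\<close>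

lemma fock_line_eq_iff:
  assumes "A \<in> SO10" "B \<in> SO10"
  shows "fock_line A = fock_line B \<longleftrightarrow> (\<forall>x. (transpose B ** A) *v times_i x = times_i ((transpose B ** A) *v x))"
proof -
  have B: "transpose B ** B = mat 1" "B ** transpose B = mat 1"
    using assms by (auto simp: SO10_def orthogonal_matrix_def)
  have A: "transpose A ** A = mat 1" "A ** transpose A = mat 1"
    using assms by (auto simp: SO10_def orthogonal_matrix_def)
  define h where "h = transpose B ** A"
  have hB: "A = B ** h" by (simp add: h_def matrix_mul_assoc B)
  have surj: "\<exists>z. y = h *v z" for y
  proof (rule exI[of _ "(transpose A ** B) *v y"])
    have "h ** (transpose A ** B) = transpose B ** (A ** transpose A) ** B"
      by (simp add: h_def matrix_mul_assoc)
    thus "y = h *v ((transpose A ** B) *v y)" by (simp add: matrix_vector_mul_assoc A B)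
  qed
  obtain \<psi> where \<psi>: "fock_line A = range (\<lambda>c. c *s \<psi>)" "\<psi> \<noteq> 0" using fock_line_SO10[OF assms(1)] by blast
  have "h *v times_i x = times_i (h *v x)" if eq: "fock_line A = fock_line B" for x
  proof -
    have "\<psi> \<in> fock_line A" unfolding \<psi>(1) by (rule range_eqI[of _ _ 1]) simp
    hence mem: "\<psi> \<in> fock_line A" "\<psi> \<in> fock_line B" using eq by simp_all
    have "cliff (cvec (A *v x) + \<i> *s cvec (A *v times_i x)) *v \<psi> = 0"
         "cliff (cvec (B *v (h *v x)) + \<i> *s cvec (B *v times_i (h *v x))) *v \<psi> = 0"
      using mem unfolding fock_line_def by blast+
    hence "cliff ((cvec (A *v x) + \<i> *s cvec (A *v times_i x)) - (cvec (A *v x) + \<i> *s cvec (B *v times_i (h *v x)))) *v \<psi> = 0"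
      by (simp only: cliff_diff matrix_vector_mul_assoc hB diff_self)
    also have "(cvec (A *v x) + \<i> *s cvec (A *v times_i x)) - (cvec (A *v x) + \<i> *s cvec (B *v times_i (h *v x)))
        = \<i> *s cvec (A *v times_i x - B *v times_i (h *v x))"
      by (simp only: cvec_simps vector_ssub_ldistrib add_diff_cancel_left)
    finally have "cliff (cvec (A *v times_i x - B *v times_i (h *v x))) *v \<psi> = 0"
      by (simp only: cliff_scale vector_mul_eq_0 complex_i_not_zero simp_thms)
    from cliff_cvec_eq_0D[OF this \<psi>(2)] have "A *v times_i x = B *v times_i (h *v x)" by simp
    hence "transpose B *v (A *v times_i x) = transpose B *v (B *v times_i (h *v x))" by simp
    thus ?thesis by (simp only: matrix_vector_mul_assoc B h_def matrix_vector_mul_lid)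
  qed
  moreover have "fock_line A = fock_line B" if c: "\<forall>x. h *v times_i x = times_i (h *v x)"
  proof -
    have "(\<forall>x. P (h *v x)) \<longleftrightarrow> (\<forall>y. P y)" for P using surj by metis
    from this[of "\<lambda>y. cliff (cvec (B *v y) + \<i> *s cvec (B *v times_i y)) *v \<phi> = 0" for \<phi>]
    show ?thesis by (simp add: fock_line_def hB matrix_vector_mul_assoc[symmetric] c)
  qed
  ultimately show ?thesis unfolding h_def by blast
qed

lemma coset_U5_eq_iff:
  assumes "A \<in> SO10" "B \<in> SO10"
  shows "coset_U5 A = coset_U5 B \<longleftrightarrow> fock_line A = fock_line B"
proof -
  have B: "transpose B ** B = mat 1" using assms by (auto simp: SO10_def orthogonal_matrix_def)
  have sub: "coset_U5 A \<subseteq> coset_U5 B" if "fock_line A = fock_line B" "A \<in> SO10" "B \<in> SO10" for A B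
  proof -
    have o: "orthogonal_matrix A" "orthogonal_matrix B" "B ** transpose B = mat 1"
      using that by (auto simp: SO10_def orthogonal_matrix_def)
    have "transpose B ** A \<in> U5"
      using that o fock_line_eq_iff[of A B] by (intro orthogonal_commutes_U5) (auto intro: orthogonal_matrix_mul)
    moreover have "A ** h = B ** ((transpose B ** A) ** h)" for h
      by (simp add: matrix_mul_assoc o)
    ultimately show ?thesis unfolding coset_U5_def using U5_mult by blast
  qed
  have "fock_line A = fock_line B" if "coset_U5 A = coset_U5 B"
  proof -
    have "A \<in> coset_U5 A" unfolding coset_U5_def by (rule image_eqI[OF _ U5_one]) simp
    hence "A \<in> coset_U5 B" using that by simp
    then obtain h where "h \<in> U5" "A = B ** h" by (auto simp: coset_U5_def)
    hence "transpose B ** A \<in> U5" by (simp add: matrix_mul_assoc B)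
    thus ?thesis using fock_line_eq_iff[OF assms] U5_commutes by blast
  qed
  thus ?thesis using sub assms by blast
qed

section \<open>The quotient topology\<close>

lemma openin_quot_topology:
  "openin (quot_topology T f) U \<longleftrightarrow> U \<subseteq> f ` topspace T \<and> openin T {x \<in> topspace T. f x \<in> U}"
proof -
  let ?P = "\<lambda>U. U \<subseteq> f ` topspace T \<and> openin T {x \<in> topspace T. f x \<in> U}"
  have "istopology ?P"
    unfolding istopology_def
  proof (intro conjI allI impI)
    fix S S' assume S: "?P S" "?P S'"
    have "{x \<in> topspace T. f x \<in> S \<inter> S'} = {x \<in> topspace T. f x \<in> S} \<inter> {x \<in> topspace T. f x \<in> S'}" by auto
    thus "S \<inter> S' \<subseteq> f ` topspace T" "openin T {x \<in> topspace T. f x \<in> S \<inter> S'}" using S by auto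
  next
    fix \<K> assume K: "\<forall>S\<in>\<K>. ?P S"
    have "{x \<in> topspace T. f x \<in> \<Union>\<K>} = (\<Union>S\<in>\<K>. {x \<in> topspace T. f x \<in> S})" by auto
    moreover have "openin T (\<Union>S\<in>\<K>. {x \<in> topspace T. f x \<in> S})" using K by (intro openin_Union) auto
    ultimately show "\<Union>\<K> \<subseteq> f ` topspace T" "openin T {x \<in> topspace T. f x \<in> \<Union>\<K>}" using K by auto
  qed
  thus ?thesis unfolding quot_topology_def by (simp add: topology_inverse')
qed

lemma topspace_quot_topology: "topspace (quot_topology T f) = f ` topspace T"
proof
  show "topspace (quot_topology T f) \<subseteq> f ` topspace T"
    using openin_topspace[of "quot_topology T f"] unfolding openin_quot_topology by blast
  have "{x \<in> topspace T. f x \<in> f ` topspace T} = topspace T" by auto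
  hence "openin (quot_topology T f) (f ` topspace T)" by (simp add: openin_quot_topology)
  thus "f ` topspace T \<subseteq> topspace (quot_topology T f)" by (rule openin_subset)
qed

lemma quotient_map_quot_topology: "quotient_map T (quot_topology T f) f"
  by (auto simp: quotient_map_def topspace_quot_topology openin_quot_topology)

lemma closedin_quot_topology:
  "closedin (quot_topology T f) C \<longleftrightarrow> C \<subseteq> f ` topspace T \<and> closedin T {x \<in> topspace T. f x \<in> C}"
  using quotient_map_quot_topology[of T f] closedin_subset[of "quot_topology T f" C]
  unfolding quotient_map_closedin topspace_quot_topology by blast

section \<open>Closedness of the incidence relation\<close>

lemma compact_SO10: "compact SO10"
proof -
  have "norm A \<le> real (card (UNIV :: 10 set))" if "A \<in> SO10" for A
  proof -
    have "orthogonal_matrix A" using that by (simp add: SO10_def)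
    hence "norm (A$i) = 1" for i
      unfolding orthogonal_matrix_orthonormal_rows by (simp add: row_def)
    hence "(\<Sum>i\<in>UNIV. norm (A$i)) = real (card (UNIV :: 10 set))" by simp
    thus ?thesis using L2_set_le_sum[of UNIV "\<lambda>i. norm (A$i)"] by (simp add: norm_vec_def)
  qed
  hence "bounded SO10" unfolding bounded_iff by blast
  moreover have "closed SO10"
  proof -
    have "SO10 = {A. (\<forall>i j. (\<Sum>k\<in>UNIV. A$k$i * A$k$j) = (if i = j then 1 else 0)) \<and> det A = 1}"
      by (simp add: SO10_def orthogonal_matrix transpose_def matrix_matrix_mult_def mat_def vec_eq_iff)
    also have "closed \<dots>"
      unfolding det_def
      by (intro closed_Collect_conj closed_Collect_all closed_Collect_eq continuous_intros)
    finally show ?thesis .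
  qed
  ultimately show ?thesis by (simp add: compact_eq_bounded_closed)
qed

text \<open>The condition is a family of equations that are polynomial in the entries of \<open>A\<close> and \<open>\<psi>\<close>.\<close>

lemma closed_fock_line_incidence: "closed {p. snd p \<in> fock_line (fst p)}"
proof -
  have unf: "(cliff (cvec (A *v x) + \<i> *s cvec (A *v y)) *v \<psi>) = 0 \<longleftrightarrow>
     (\<forall>k. (\<Sum>i\<in>UNIV. (complex_of_real (\<Sum>j\<in>UNIV. A$i$j * x$j) + \<i> * complex_of_real (\<Sum>j\<in>UNIV. A$i$j * y$j))
        * (\<Sum>l\<in>UNIV. \<gamma>$i$k$l * \<psi>$l)) = 0)" for A x y \<psi>
    unfolding cliff_gamma by (simp add: vec_eq_iff cvec_def matrix_vector_mult_def distrib_right)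
  have eq: "{p. snd p \<in> fock_line (fst p)} = {p. \<forall>x k. (\<Sum>i\<in>UNIV. (complex_of_real (\<Sum>j\<in>UNIV. fst p$i$j * x$j) + \<i> * complex_of_real (\<Sum>j\<in>UNIV. fst p$i$j * times_i x$j))
        * (\<Sum>l\<in>UNIV. \<gamma>$i$k$l * snd p$l)) = 0}"
    by (simp only: fock_line_def mem_Collect_eq unf)
  show ?thesis
    unfolding eq by (intro closed_Collect_all closed_Collect_eq continuous_intros)
qed

section \<open>Lines of pure spinors\<close>

lemma cline_spinor: "cline (0, \<psi>, 0) = range (\<lambda>c. (0, c *s \<psi>, 0))"
  by (simp add: cline_def)

lemma cline_self: "w \<in> cline w"
  by (cases w) (auto simp: cline_def image_iff intro!: exI[of _ 1])

lemma cline_spinor_eq_iff: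
  assumes "\<phi> \<noteq> 0" "\<psi> \<noteq> 0"
  shows "cline (0, \<phi>, 0) = cline (0, \<psi>, 0) \<longleftrightarrow> (\<exists>c. c \<noteq> 0 \<and> \<phi> = c *s \<psi>)"
proof
  assume "cline (0, \<phi>, 0) = cline (0, \<psi>, 0)"
  hence "(0, \<phi>, 0) \<in> cline (0, \<psi>, 0)" using cline_self[of "(0, \<phi>, 0)"] by simp
  then obtain c where "\<phi> = c *s \<psi>" by (auto simp: cline_spinor)
  thus "\<exists>c. c \<noteq> 0 \<and> \<phi> = c *s \<psi>" using assms by auto
next
  assume "\<exists>c. c \<noteq> 0 \<and> \<phi> = c *s \<psi>"
  then obtain c where c: "c \<noteq> 0" "\<phi> = c *s \<psi>" by blast
  have "d *s \<phi> = (d * c) *s \<psi>" "d *s \<psi> = (d / c) *s \<phi>" for d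
    using c by (simp_all add: vector_smult_assoc)
  thus "cline (0, \<phi>, 0) = cline (0, \<psi>, 0)" unfolding cline_spinor by fastforce
qed

lemma pluecker_spinor: "pluecker (0, \<psi>, 0) \<longleftrightarrow> (\<forall>i. spin_form \<psi> (\<gamma>$i) \<psi> = 0)"
proof -
  have "(\<Sum>i\<in>UNIV. spin_form \<psi> (\<gamma>$i) \<psi> *s axis i 1) = (\<chi> i. spin_form \<psi> (\<gamma>$i) \<psi>)"
    using basis_expansion[of "\<chi> i. spin_form \<psi> (\<gamma>$i) \<psi>"] by simp
  thus ?thesis by (simp add: cliff_zero vec_eq_iff)
qed

lemma pure_spinor_scale: "pure_spinor \<psi> \<Longrightarrow> pure_spinor (c *s \<psi>)"
  by (simp add: pure_spinor_iff_pairing Delta_plus_scale vector_scalar_commute spinor_pairing_linear)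

lemma X_infinity_pure: "(\<lambda>\<psi>. cline (0, \<psi>, 0)) ` {\<psi>. pure_spinor \<psi> \<and> \<psi> \<noteq> 0} = X_infinity"
proof
  show "(\<lambda>\<psi>. cline (0, \<psi>, 0)) ` {\<psi>. pure_spinor \<psi> \<and> \<psi> \<noteq> 0} \<subseteq> X_infinity"
  proof clarify
    fix \<psi> assume \<psi>: "pure_spinor \<psi>" "\<psi> \<noteq> 0"
    have "(0, \<psi>, 0) \<in> rep27 - {0}" using \<psi> by (auto simp: rep27_def pure_spinor_def zero_prod_def)
    hence "cline (0, \<psi>, 0) \<in> CP26" by (auto simp: CP26_def)
    moreover have "pluecker (0, c *s \<psi>, 0)" for c
      using pure_spinor_scale[OF \<psi>(1)] unfolding pluecker_spinor pure_spinor_def by blast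
    ultimately show "cline (0, \<psi>, 0) \<in> X_infinity"
      unfolding X_infinity_def X_var_def by (auto simp: cline_spinor simp del: pluecker.simps)
  qed
  show "X_infinity \<subseteq> (\<lambda>\<psi>. cline (0, \<psi>, 0)) ` {\<psi>. pure_spinor \<psi> \<and> \<psi> \<noteq> 0}"
  proof
    fix p assume p: "p \<in> X_infinity"
    then obtain v \<psi> s where w: "(v, \<psi>, s) \<in> rep27 - {0}" "p = cline (v, \<psi>, s)"
      by (auto simp: X_infinity_def X_var_def CP26_def)
    have "(v, \<psi>, s) \<in> p" using w(2) cline_self by simp
    hence vs: "s = 0" "v = 0" and "pluecker (v, \<psi>, s)"
      using p by (auto simp: X_infinity_def X_var_def simp del: pluecker.simps)
    hence "pure_spinor \<psi>" "\<psi> \<noteq> 0"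
      using w(1) by (auto simp: pure_spinor_def rep27_def pluecker_spinor zero_prod_def simp del: pluecker.simps)
    thus "p \<in> (\<lambda>\<psi>. cline (0, \<psi>, 0)) ` {\<psi>. pure_spinor \<psi> \<and> \<psi> \<noteq> 0}" using w(2) vs by blast
  qed
qed

section \<open>The homeomorphism\<close>

text \<open>The line of \<open>A\<close> as a point of the projective space.\<close>

definition fock_point :: "real^10^10 \<Rightarrow> vec27 set" where
  "fock_point A = (\<lambda>\<psi>. (0, \<psi>, 0)) ` fock_line A"

lemma fock_point_eq_cline:
  assumes A: "A \<in> SO10" and \<psi>: "\<psi> \<in> fock_line A" "\<psi> \<noteq> 0"
  shows "fock_point A = cline (0, \<psi>, 0)" "pure_spinor \<psi>"
proof -
  obtain \<phi> where \<phi>: "fock_line A = range (\<lambda>c. c *s \<phi>)" "\<phi> \<noteq> 0" "pure_spinor \<phi>"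
    using fock_line_SO10[OF A] by blast
  then obtain c where c: "\<psi> = c *s \<phi>" using \<psi>(1) by blast
  thus "pure_spinor \<psi>" using pure_spinor_scale \<phi>(3) by blast
  have "c \<noteq> 0" using c \<psi>(2) by auto
  hence "cline (0, \<psi>, 0) = cline (0, \<phi>, 0)" using cline_spinor_eq_iff[OF \<psi>(2) \<phi>(2)] c by blast
  thus "fock_point A = cline (0, \<psi>, 0)" by (simp add: fock_point_def \<phi>(1) cline_spinor image_image)
qed

lemma fock_line_nonzero: "A \<in> SO10 \<Longrightarrow> \<exists>\<psi>. \<psi> \<in> fock_line A \<and> \<psi> \<noteq> 0"
  by (metis fock_line_SO10 rangeI vector_smult_lid)

lemma cline_eq_fock_point_iff:
  assumes A: "A \<in> SO10" and w: "(v, \<psi>, s) \<in> rep27 - {0}"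
  shows "cline (v, \<psi>, s) = fock_point A \<longleftrightarrow> v = 0 \<and> s = 0 \<and> \<psi> \<in> fock_line A"
proof
  assume "cline (v, \<psi>, s) = fock_point A"
  thus "v = 0 \<and> s = 0 \<and> \<psi> \<in> fock_line A" using cline_self[of "(v, \<psi>, s)"] by (auto simp: fock_point_def)
next
  assume "v = 0 \<and> s = 0 \<and> \<psi> \<in> fock_line A"
  moreover from this have "\<psi> \<noteq> 0" using w by (auto simp: zero_prod_def)
  ultimately show "cline (v, \<psi>, s) = fock_point A" using fock_point_eq_cline(1)[OF A] by metis
qed

lemma fock_point_image: "fock_point ` SO10 = X_infinity"
proof
  show "fock_point ` SO10 \<subseteq> X_infinity"
    using fock_line_nonzero fock_point_eq_cline by (fastforce simp flip: X_infinity_pure)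
  show "X_infinity \<subseteq> fock_point ` SO10"
  proof
    fix p assume "p \<in> X_infinity"
    then obtain \<psi> where \<psi>: "pure_spinor \<psi>" "\<psi> \<noteq> 0" "p = cline (0, \<psi>, 0)"
      by (auto simp flip: X_infinity_pure)
    then obtain A where "A \<in> SO10" "\<psi> \<in> fock_line A" using pure_spinor_in_fock_line by blast
    thus "p \<in> fock_point ` SO10" using fock_point_eq_cline(1) \<psi> by blast
  qed
qed

lemma X_infinity_subset_CP26: "X_infinity \<subseteq> CP26"
  by (auto simp: X_infinity_def X_var_def)

lemma topspace_CP26: "topspace CP26_topology = CP26"
  by (simp add: CP26_topology_def CP26_def topspace_quot_topology)

text \<open>The cone over the image of a closed set \<open>C\<close> of matrices is the projection of the closed incidence
  relation along the compact set \<open>C\<close>.\<close>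

lemma closed_map_fock_point:
  "closed_map (top_of_set SO10) (subtopology CP26_topology X_infinity) fock_point"
  unfolding closed_map_def
proof (intro allI impI)
  fix C assume C: "closedin (top_of_set SO10) C"
  have CS: "C \<subseteq> SO10" using closedin_subset[OF C] by simp
  have "compact C" using C compact_SO10 closedin_compact by blast
  have "closed {p :: (real^10^10) \<times> vec27. fst (snd p) = 0 \<and> snd (snd (snd p)) = 0
      \<and> (fst p, fst (snd (snd p))) \<in> {q. snd q \<in> fock_line (fst q)}}"
    by (intro closed_Collect_conj closed_Collect_eq closed_vimage[OF closed_fock_line_incidence, unfolded vimage_def] continuous_intros)
  from closed_compact_projection[OF \<open>compact C\<close> this]
  have D: "closed {w :: vec27. \<exists>A. A \<in> C \<and> fst w = 0 \<and> snd (snd w) = 0 \<and> fst (snd w) \<in> fock_line A}"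
    (is "closed ?D") by (simp only: mem_Collect_eq fst_conv snd_conv)
  have "{w \<in> rep27 - {0}. cline w \<in> fock_point ` C} = (rep27 - {0}) \<inter> ?D"
  proof (rule set_eqI)
    fix w :: vec27
    obtain v \<psi> s where w: "w = (v, \<psi>, s)" by (cases w)
    show "w \<in> {w \<in> rep27 - {0}. cline w \<in> fock_point ` C} \<longleftrightarrow> w \<in> (rep27 - {0}) \<inter> ?D"
    proof (cases "w \<in> rep27 - {0}")
      case True
      have "cline w = fock_point A \<longleftrightarrow> v = 0 \<and> s = 0 \<and> \<psi> \<in> fock_line A" if "A \<in> C" for A
        using cline_eq_fock_point_iff[of A v \<psi> s] CS that True unfolding w by auto
      thus ?thesis using True by (auto simp: w image_iff)
    qed auto
  qed
  hence "closedin (top_of_set (rep27 - {0})) {w \<in> rep27 - {0}. cline w \<in> fock_point ` C}"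
    using closedin_closed_Int[OF D, of "rep27 - {0}"] by simp
  moreover have sub: "fock_point ` C \<subseteq> X_infinity" using CS fock_point_image by blast
  ultimately have "closedin CP26_topology (fock_point ` C)"
    unfolding CP26_topology_def closedin_quot_topology
    using X_infinity_subset_CP26 by (auto simp: CP26_def)
  thus "closedin (subtopology CP26_topology X_infinity) (fock_point ` C)"
    using sub by (rule closedin_subset_topspace)
qed

text \<open>Dually, the preimage of a closed set of lines is the projection of a closed set of pairs along the
  unit sphere of \<open>\<Delta>\<^sup>+\<close>, which is compact and meets every line in \<open>\<Delta>\<^sup>+\<close>.\<close>

lemma continuous_map_fock_point:
  "continuous_map (top_of_set SO10) (subtopology CP26_topology X_infinity) fock_point"
  unfolding continuous_map_in_subtopology
proof
  show "continuous_map (top_of_set SO10) CP26_topology fock_point"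
    unfolding continuous_map_closedin
  proof (intro conjI allI impI)
    show "fock_point \<in> topspace (top_of_set SO10) \<rightarrow> topspace CP26_topology"
      using fock_point_image X_infinity_subset_CP26 by (auto simp: topspace_CP26)
    fix V assume "closedin CP26_topology V"
    hence "closedin (top_of_set (rep27 - {0})) {w \<in> rep27 - {0}. cline w \<in> V}"
      by (simp add: CP26_topology_def closedin_quot_topology)
    then obtain E where E: "closed E" "{w \<in> rep27 - {0}. cline w \<in> V} = (rep27 - {0}) \<inter> E"
      unfolding closedin_closed by blast
    define S where "S = sphere 0 1 \<inter> \<Delta>_plus"
    have "closed \<Delta>_plus"
      unfolding \<Delta>_plus_def
      by (intro closed_Collect_eq continuous_intros matrix_vector_mult_linear_continuous_on)
    hence "compact S" unfolding S_def by (intro compact_Int_closed) simp_all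
    have "closed {p :: spinor \<times> (real^10^10). (snd p, fst p) \<in> {q. snd q \<in> fock_line (fst q)} \<and> (0, fst p, 0) \<in> E}"
      by (intro closed_Collect_conj closed_vimage[OF closed_fock_line_incidence, unfolded vimage_def]
            closed_vimage[OF E(1), unfolded vimage_def] continuous_intros)
    hence "closedin (top_of_set (S \<times> SO10)) ((S \<times> SO10) \<inter> {p. (snd p, fst p) \<in> {q. snd q \<in> fock_line (fst q)} \<and> (0, fst p, 0) \<in> E})"
      by (rule closedin_closed_Int)
    from closedin_compact_projection[OF \<open>compact S\<close> this]
    have "closedin (top_of_set SO10) {A \<in> SO10. \<exists>\<psi>. \<psi> \<in> S \<and> \<psi> \<in> fock_line A \<and> (0, \<psi>, 0) \<in> E}"
      by (rule back_subst[of "closedin (top_of_set SO10)"]) auto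
    moreover have "fock_point A \<in> V \<longleftrightarrow> (\<exists>\<psi>. \<psi> \<in> S \<and> \<psi> \<in> fock_line A \<and> (0, \<psi>, 0) \<in> E)" if A: "A \<in> SO10" for A
    proof -
      have iff: "fock_point A \<in> V \<longleftrightarrow> (0, \<psi>, 0) \<in> E" if "\<psi> \<in> S" "\<psi> \<in> fock_line A" for \<psi>
      proof -
        have "\<psi> \<noteq> 0" using that by (auto simp: S_def)
        hence "(0, \<psi>, 0) \<in> rep27 - {0}" using that by (auto simp: S_def rep27_def zero_prod_def)
        hence "cline (0, \<psi>, 0) \<in> V \<longleftrightarrow> (0, \<psi>, 0) \<in> E" using E(2) by blast
        thus ?thesis using fock_point_eq_cline(1)[OF A that(2) \<open>\<psi> \<noteq> 0\<close>] by simp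
      qed
      have "\<exists>\<psi>. \<psi> \<in> S \<and> \<psi> \<in> fock_line A"
      proof -
        obtain \<phi> where \<phi>: "\<phi> \<in> fock_line A" "\<phi> \<noteq> 0" using fock_line_nonzero[OF A] by blast
        define r where "r = complex_of_real (inverse (norm \<phi>))"
        have r: "r *s \<phi> = \<phi> /\<^sub>R norm \<phi>" by (simp add: r_def vec_eq_iff scaleR_conv_of_real[where 'a=complex])
        have "r *s \<phi> \<in> fock_line A" using \<phi>(1) by (simp add: fock_line_def vector_scalar_commute)
        moreover have "r *s \<phi> \<in> \<Delta>_plus"
          using fock_point_eq_cline(2)[OF A \<phi>] pure_spinor_def Delta_plus_scale by blast
        moreover have "norm (r *s \<phi>) = 1" unfolding r using \<phi>(2) by simp
        ultimately show ?thesis by (auto simp: S_def)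
      qed
      thus ?thesis using iff by blast
    qed
    ultimately show "closedin (top_of_set SO10) {x \<in> topspace (top_of_set SO10). fock_point x \<in> V}"
      by (simp cong: conj_cong)
  qed
  show "fock_point \<in> topspace (top_of_set SO10) \<rightarrow> X_infinity" using fock_point_image by auto
qed

lemma fock_point_eq_iff: "fock_point A = fock_point B \<longleftrightarrow> fock_line A = fock_line B"
  unfolding fock_point_def by (rule inj_image_eq_iff) (auto intro: injI)

lemma fock_point_lifts:
  assumes "lifts g B"
  shows "fock_point (B ** A) = spin_act g ` fock_point A"
  by (simp add: fock_point_def fock_line_lifts[OF assms] image_image)

theorem lemma2p7:
  shows "(\<lambda>\<psi>. cline (0, \<psi>, 0)) ` {\<psi>. pure_spinor \<psi> \<and> \<psi> \<noteq> 0} = X_infinity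
    \<and> (\<forall>\<phi> \<psi>. pure_spinor \<phi> \<and> \<phi> \<noteq> 0 \<and> pure_spinor \<psi> \<and> \<psi> \<noteq> 0 \<longrightarrow>
          (cline (0, \<phi>, 0) = cline (0, \<psi>, 0) \<longleftrightarrow> (\<exists>c. c \<noteq> 0 \<and> \<phi> = c *s \<psi>)))
    \<and> (\<exists>F. homeomorphic_map SO10_mod_U5 (subtopology CP26_topology X_infinity) F
          \<and> (\<forall>g\<in>Spin10. \<forall>A\<in>SO10.
               F (coset_U5 (vec_rep g ** A)) = spin_act g ` F (coset_U5 A)))"
proof (intro conjI allI impI)
  show "(\<lambda>\<psi>. cline (0, \<psi>, 0)) ` {\<psi>. pure_spinor \<psi> \<and> \<psi> \<noteq> 0} = X_infinity" by (rule X_infinity_pure)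
  show "cline (0, \<phi>, 0) = cline (0, \<psi>, 0) \<longleftrightarrow> (\<exists>c. c \<noteq> 0 \<and> \<phi> = c *s \<psi>)"
    if "pure_spinor \<phi> \<and> \<phi> \<noteq> 0 \<and> pure_spinor \<psi> \<and> \<psi> \<noteq> 0" for \<phi> \<psi>
    using that by (intro cline_spinor_eq_iff) auto
  \<comment> \<open>By \<open>coset_U5_eq_iff\<close> the value does not depend on the chosen representative of the coset.\<close>
  define F where "F S = fock_point (SOME A. A \<in> SO10 \<and> coset_U5 A = S)" for S
  have F: "F (coset_U5 A) = fock_point A" if A: "A \<in> SO10" for A
  proof -
    let ?B = "SOME B. B \<in> SO10 \<and> coset_U5 B = coset_U5 A"
    have "?B \<in> SO10 \<and> coset_U5 ?B = coset_U5 A" by (rule someI[of _ A]) (simp add: A)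
    thus ?thesis using coset_U5_eq_iff[of ?B A] A by (simp add: F_def fock_point_eq_iff)
  qed
  let ?Y = "subtopology CP26_topology X_infinity"
  have q: "quotient_map (top_of_set SO10) SO10_mod_U5 coset_U5"
    unfolding SO10_mod_U5_def by (rule quotient_map_quot_topology)
  have top: "topspace SO10_mod_U5 = coset_U5 ` SO10"
    by (simp add: SO10_mod_U5_def topspace_quot_topology)
  have topY: "topspace ?Y = X_infinity"
    using X_infinity_subset_CP26 by (auto simp: topspace_CP26)
  have cont: "continuous_map (top_of_set SO10) ?Y (F \<circ> coset_U5)"
    by (rule continuous_map_eq[OF continuous_map_fock_point]) (simp add: F)
  have clo: "closed_map (top_of_set SO10) ?Y (F \<circ> coset_U5)"
    by (rule closed_map_eq[OF closed_map_fock_point]) (simp add: F)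
  have "homeomorphic_map SO10_mod_U5 ?Y F"
  proof (rule bijective_closed_imp_homeomorphic_map)
    show "continuous_map SO10_mod_U5 ?Y F"
      using cont q continuous_compose_quotient_map by blast
    show "closed_map SO10_mod_U5 ?Y F"
      using closed_map_from_composition_left[OF clo quotient_imp_continuous_map[OF q]] top by simp
    show "F ` topspace SO10_mod_U5 = topspace ?Y"
    proof -
      have "F ` (coset_U5 ` SO10) = fock_point ` SO10" by (simp add: image_image F)
      thus ?thesis unfolding top topY by (simp only: fock_point_image)
    qed
    show "inj_on F (topspace SO10_mod_U5)"
      unfolding top by (auto simp: inj_on_def F coset_U5_eq_iff fock_point_eq_iff)
  qed
  moreover have "F (coset_U5 (vec_rep g ** A)) = spin_act g ` F (coset_U5 A)" if g: "g \<in> Spin10" and A: "A \<in> SO10" for g A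
  proof -
    obtain B where B: "lifts g B" "det B = 1" using Spin10_lifts[OF g] by blast
    have "B ** A \<in> SO10"
      using A lifts_orthogonal[OF B(1)] B(2) by (simp add: SO10_def orthogonal_matrix_mul det_mul)
    thus ?thesis using F A by (simp add: vec_rep_lifts[OF B] fock_point_lifts[OF B(1)])
  qed
  ultimately show "\<exists>F. homeomorphic_map SO10_mod_U5 ?Y F
          \<and> (\<forall>g\<in>Spin10. \<forall>A\<in>SO10. F (coset_U5 (vec_rep g ** A)) = spin_act g ` F (coset_U5 A))"
    by blast
qed

end
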